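(* Let $d\ge 2$ be an integer, let $1\le p\le 2$, and let $\psi:[1,\infty)\to(0,\infty)$ be a non-increasing function satisfying $\sum_{k=1}^{\infty}\psi(k)<\infty$. Let $f\in L^p(\mathbb{T}^d)$, and assume that there is a constant $A(f)$ (depending on $f$ but not on $\delta$) such that $$\omega(\delta,f)_p\le A(f)\,\bigl(\log(1/\delta)\bigr)^{-d/p}\,\psi\bigl(\log\log(e^e/\delta)\bigr),\qquad 0<\delta\le\tfrac12 .$$ Then the rectangular partial sums of the Fourier series of $f$ converge to $f$ almost everywhere in the sense of Pringsheim; that is, for almost every $x\in\mathbb{T}^d$, $$S_{\mathbf{n}}f(x)\to f(x)\qquad\text{as }\min_{1\le j\le d}n_j\to\infty .$$
   Context: $\mathbb{T}=\mathbb{R}/(2\pi\mathbb{Z})$, and $\mathbb{T}^d$ carries the normalized Haar measure $dm_d(x)=(2\pi)^{-d}dx$; $\|\cdot\|_p$ is the norm of $L^p(\mathbb{T}^d)$ with respect to $m_d$. For $t\in\mathbb{T}$, $|t|_{\mathbb{T}}=\operatorname{dist}(t,2\pi\mathbb{Z})\in[0,\pi]$, and for $h=(h_1,\dots,h_d)\in\mathbb{T}^d$, $\|h\|_{\mathbb{T}^d}=\max_{1\le j\le d}|h_j|_{\mathbb{T}}$. The $L^p$ modulus of continuity is $\omega(\delta,f)_p=\sup_{\|h\|_{\mathbb{T}^d}\le\delta}\|f(\cdot+h)-f(\cdot)\|_p$ for $\delta>0$. Fourier coefficients: $\widehat f(\mathbf{k})=\int_{\mathbb{T}^d}f(x)e^{-i\mathbf{k}\cdot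 x}\,dm_d(x)$, $\mathbf{k}\in\mathbb{Z}^d$. For $\mathbf{n}=(n_1,\dots,n_d)\in\mathbb{N}_0^d$ the symmetric rectangular partial sum is $$S_{\mathbf{n}}f(x)=\sum_{|k_1|\le n_1}\cdots\sum_{|k_d|\le n_d}\widehat f(\mathbf{k})e^{i\mathbf{k}\cdot x}.$$ All logarithms are natural. *)

theory Defs
  imports "HOL-Analysis.Analysis"
begin

text \<open>
  Points of the torus \<open>(\<real> / 2\<pi>\<int>)\<^sup>d\<close> are represented by vectors in \<open>real ^ 'd\<close>, with \<open>d = CARD('d)\<close>,
  and functions on the torus by functions on \<open>real ^ 'd\<close> that are periodic under the lattice
  \<open>(2\<pi>\<int>)\<^sup>d\<close>. Integration and null sets live on the fundamental cell \<open>[0, 2\<pi>)\<^sup>d\<close>.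
\<close>

definition torus_periodic :: "(real ^ 'd \<Rightarrow> 'a) \<Rightarrow> bool" where
  "torus_periodic f \<longleftrightarrow>
     (\<forall>x. \<forall>k :: int ^ 'd. f (x + (\<chi> j. 2 * pi * of_int (k $ j))) = f x)"

definition torus_cell :: "(real ^ 'd) set" where
  "torus_cell = {x. \<forall>j. 0 \<le> x $ j \<and> x $ j < 2 * pi}"

definition torus_measure :: "(real ^ 'd) measure" where
  "torus_measure =
     scale_measure (ennreal (1 / (2 * pi) ^ CARD('d))) (restrict_space lebesgue torus_cell)"

definition torus_Lp :: "real \<Rightarrow> (real ^ 'd \<Rightarrow> complex) set" where
  "torus_Lp p = {f. torus_periodic f \<and> f \<in> borel_measurable torus_measure
                    \<and> integrable torus_measure (\<lambda>x. norm (f x) powr p)}"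

definition torus_Lp_norm :: "real \<Rightarrow> (real ^ 'd \<Rightarrow> complex) \<Rightarrow> real" where
  "torus_Lp_norm p f = (\<integral>x. norm (f x) powr p \<partial>torus_measure) powr (1 / p)"

definition circle_abs :: "real \<Rightarrow> real" where
  "circle_abs t = infdist t (range (\<lambda>k :: int. 2 * pi * of_int k))"

definition torus_norm :: "real ^ 'd \<Rightarrow> real" where
  "torus_norm h = Max (range (\<lambda>j. circle_abs (h $ j)))"

text \<open>
  The supremum is taken in the reals. For \<open>f \<in> torus_Lp p\<close> with \<open>p \<ge> 1\<close> and \<open>\<delta> > 0\<close> the set is
  nonempty and bounded by twice the norm of \<open>f\<close>, so it is a genuine supremum.
\<close>

definition Lp_modulus :: "real \<Rightarrow> real \<Rightarrow> (real ^ 'd \<Rightarrow> complex) \<Rightarrow> real" where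
  "Lp_modulus p \<delta> f =
     (SUP h \<in> {h. torus_norm h \<le> \<delta>}. torus_Lp_norm p (\<lambda>x. f (x + h) - f x))"

definition torus_character :: "int ^ 'd \<Rightarrow> real ^ 'd \<Rightarrow> complex" where
  "torus_character k x = exp (\<i> * complex_of_real (\<Sum>j\<in>UNIV. of_int (k $ j) * x $ j))"

definition fourier_coeff :: "(real ^ 'd \<Rightarrow> complex) \<Rightarrow> int ^ 'd \<Rightarrow> complex" where
  "fourier_coeff f k = (\<integral>x. f x * torus_character (- k) x \<partial>torus_measure)"

definition rect_frequencies :: "nat ^ 'd \<Rightarrow> (int ^ 'd) set" where
  "rect_frequencies n = {k. \<forall>j. \<bar>k $ j\<bar> \<le> int (n $ j)}"

lemma finite_rect_frequencies: "finite (rect_frequencies (n :: nat ^ 'd))"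
proof -
  have "rect_frequencies n \<subseteq>
          (\<lambda>g. \<chi> j. g j) ` (PiE UNIV (\<lambda>j. {- int (n $ j)..int (n $ j)}))"
  proof
    fix k assume "k \<in> rect_frequencies n"
    then have "(\<lambda>j. k $ j) \<in> PiE UNIV (\<lambda>j. {- int (n $ j)..int (n $ j)})"
      by (auto simp: rect_frequencies_def abs_le_iff minus_le_iff)
    moreover have "k = (\<chi> j. k $ j)" by (simp add: vec_eq_iff)
    ultimately show "k \<in> (\<lambda>g. \<chi> j. g j) ` (PiE UNIV (\<lambda>j. {- int (n $ j)..int (n $ j)}))"
      by (metis (no_types, lifting) image_eqI)
  qed
  then show ?thesis
    by (rule finite_subset) (intro finite_imageI finite_PiE, auto)
qed

definition rect_partial_sum ::
    "nat ^ 'd \<Rightarrow> (real ^ 'd \<Rightarrow> complex) \<Rightarrow> real ^ 'd \<Rightarrow> complex" where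
  "rect_partial_sum n f x = (\<Sum>k\<in>rect_frequencies n. fourier_coeff f k * torus_character k x)"

text \<open>The filter on multi-indices expressing that the smallest component tends to infinity.\<close>

definition pringsheim :: "(nat ^ 'd) filter" where
  "pringsheim = filtercomap (\<lambda>n. Min (range (\<lambda>j. n $ j))) at_top"

end

theory Submission
  imports Defs "HOL-Probability.Probability" "HOL-Real_Asymp.Real_Asymp"
begin

text \<open>
  Let \<open>S\<^sup>*\<^sub>N g\<close> be the maximum of \<open>\<bar>S\<^sub>n g\<bar>\<close> over the indices \<open>n\<close> with all components at most \<open>N\<close>, and write
  \<open>m\<close> for a multiple of \<open>(log N)\<^sup>d\<close> bounding the \<open>L\<^sup>1\<close> norm of the supremum of the Dirichlet kernels.
  Linearizing the maximum by a measurable choice of index, its adjoint applied to a unimodular function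
  is a trigonometric polynomial \<open>P\<close> with \<open>\<bar>P\<bar> \<le> m\<close> and, by the Kolmogorov--Seliverstov argument,
  \<open>\<integral>\<bar>P\<bar>\<^sup>2 \<le> m\<close>. Interpolating pointwise between these two bounds gives
  \<open>\<parallel>S\<^sup>*\<^sub>N g\<parallel>\<^sub>1 \<le> 2 m powr (1/p) \<parallel>g\<parallel>\<^sub>p\<close> for \<open>1 \<le> p \<le> 2\<close>, that is, a loss of \<open>(log N) powr (d/p)\<close>.

  The Fejer means \<open>V\<^sub>k\<close> of degree \<open>D\<^sub>k\<close> with \<open>log D\<^sub>k\<close> comparable to \<open>exp k\<close> approximate \<open>f\<close> in \<open>L\<^sup>p\<close> up to
  \<open>\<omega>(exp (- exp k), f)\<^sub>p\<close> and a negligible error, so this loss is compensated by the hypothesis up to the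
  summable factor \<open>\<psi>(k)\<close>. Hence the maximal functions of \<open>V\<^sub>k\<^sub>+\<^sub>1 - V\<^sub>k\<close> are summable almost everywhere, and
  these control \<open>S\<^sub>n f - V\<^sub>K\<close> as soon as all components of \<open>n\<close> are at least \<open>D\<^sub>K\<close>.
\<close>

section \<open>The torus measure\<close>

lemma borel_measurable_vecI:
  fixes f :: "'a \<Rightarrow> real ^ 'd"
  assumes "\<And>j. (\<lambda>x. f x $ j) \<in> borel_measurable M"
  shows "f \<in> borel_measurable M"
  unfolding borel_measurable_euclidean_space[of f]
  using assms by (auto simp: Basis_vec_def inner_axis)

lemma borel_measurable_vec_nth [measurable]:
  fixes f :: "'a \<Rightarrow> real ^ 'd"
  assumes "f \<in> borel_measurable M"
  shows "(\<lambda>x. f x $ j) \<in> borel_measurable M"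
  by (rule measurable_compose[OF assms]) (intro borel_measurable_continuous_onI continuous_intros)

lemma nn_integral_lborel_vec_prod:
  fixes g :: "'d::finite \<Rightarrow> real \<Rightarrow> ennreal"
  assumes "\<And>j. g j \<in> borel_measurable borel"
  shows "(\<integral>\<^sup>+x. (\<Prod>j\<in>UNIV. g j (x $ j)) \<partial>(lborel :: (real ^ 'd) measure)) = (\<Prod>j\<in>UNIV. \<integral>\<^sup>+t. g j t \<partial>lborel)"
proof -
  \<comment> \<open>The product formula applied below is indexed by \<open>Basis\<close>;
    \<open>ix\<close> reads off the coordinate of an axis vector, which is unambiguous because
    distinct indices give distinct axis vectors.\<close>
  define ix :: "real ^ 'd \<Rightarrow> 'd" where "ix b = (SOME j. b = axis j 1)" for b
  have ix: "ix (axis j 1) = j" for j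
    unfolding ix_def by (rule some_equality) (auto simp: axis_eq_axis)
  have B: "(Basis :: (real ^ 'd) set) = (\<lambda>j. axis j 1) ` UNIV"
    by (auto simp: Basis_vec_def)
  have inj: "inj (\<lambda>j::'d. axis j (1::real))"
    by (auto simp: inj_def axis_eq_axis)
  have "(\<integral>\<^sup>+x. (\<Prod>b\<in>Basis. g (ix b) (x \<bullet> b)) \<partial>(lborel :: (real ^ 'd) measure))
      = (\<Prod>b\<in>(Basis :: (real ^ 'd) set). \<integral>\<^sup>+t. g (ix b) t \<partial>lborel)"
    using assms by (intro nn_integral_lborel_prod) auto
  then show ?thesis
    unfolding B by (simp add: prod.reindex[OF inj] ix inner_axis)
qed

section \<open>Reduction modulo the lattice, and the translation-invariant Borel measure on the
  cell\<close>

definition torus_lattice :: "int ^ 'd \<Rightarrow> real ^ 'd" where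
  "torus_lattice k = (\<chi> j. 2 * pi * of_int (k $ j))"

definition torus_reduce :: "real ^ 'd \<Rightarrow> real ^ 'd" where
  "torus_reduce x = (\<chi> j. x $ j - 2 * pi * of_int \<lfloor>x $ j / (2 * pi)\<rfloor>)"

lemma torus_reduce_eq: "\<exists>k. torus_reduce x = x + torus_lattice k"
  by (intro exI[of _ "\<chi> j. - \<lfloor>x $ j / (2 * pi)\<rfloor>"])
     (simp add: torus_reduce_def torus_lattice_def vec_eq_iff)

lemma torus_periodic_lattice: "torus_periodic f \<Longrightarrow> f (x + torus_lattice k) = f x"
  by (simp add: torus_periodic_def torus_lattice_def)

lemma torus_periodic_reduce: "torus_periodic f \<Longrightarrow> f (torus_reduce x) = f x"
  using torus_reduce_eq[of x] by (metis torus_periodic_lattice)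

lemma in_cell_iff: "0 \<le> t - 2 * pi * of_int n \<and> t - 2 * pi * of_int n < 2 * pi \<longleftrightarrow> n = \<lfloor>t / (2 * pi)\<rfloor>"
proof -
  have "n = \<lfloor>t / (2 * pi)\<rfloor> \<longleftrightarrow> of_int n \<le> t / (2*pi) \<and> t / (2*pi) < of_int n + 1"
    using floor_eq_iff[of "t / (2*pi)" n] by auto
  then show ?thesis
    by (simp add: pos_le_divide_eq pos_divide_less_eq algebra_simps)
qed

text \<open>The cell is half open, so every lattice orbit meets it exactly once, and the floors name
  the translate that lands in it. This uniqueness lets the unfolding in
  \<open>distr_tor_translate\<close> count every point once.\<close>

lemma torus_cell_lattice_iff:
  "x + torus_lattice k \<in> torus_cell \<longleftrightarrow> k = (\<chi> j. - \<lfloor>x $ j / (2 * pi)\<rfloor>)"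
proof -
  have "x + torus_lattice k \<in> torus_cell \<longleftrightarrow> (\<forall>j. - (k $ j) = \<lfloor>x $ j / (2 * pi)\<rfloor>)"
    unfolding in_cell_iff[symmetric] by (simp add: torus_cell_def torus_lattice_def)
  also have "\<dots> \<longleftrightarrow> k = (\<chi> j. - \<lfloor>x $ j / (2 * pi)\<rfloor>)"
    unfolding vec_eq_iff by (simp, intro all_cong1) linarith
  finally show ?thesis .
qed

lemma torus_reduce_cell: "torus_reduce x \<in> torus_cell"
proof -
  have "torus_reduce x = x + torus_lattice (\<chi> j. - \<lfloor>x $ j / (2 * pi)\<rfloor>)"
    by (simp add: torus_reduce_def torus_lattice_def vec_eq_iff)
  then show ?thesis by (simp add: torus_cell_lattice_iff)
qed

lemma torus_reduce_id: "x \<in> torus_cell \<Longrightarrow> torus_reduce x = x"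
proof -
  assume x: "x \<in> torus_cell"
  have "x + torus_lattice 0 = x" by (simp add: torus_lattice_def vec_eq_iff)
  with x have "(0::int^'a) = (\<chi> j. - \<lfloor>x $ j / (2 * pi)\<rfloor>)"
    by (metis torus_cell_lattice_iff)
  then show ?thesis
    by (simp add: torus_reduce_def vec_eq_iff)
qed

lemma torus_reduce_lattice: "torus_reduce (x + torus_lattice k) = torus_reduce x"
proof -
  have "(x $ j + 2 * pi * of_int (k $ j)) / (2 * pi) = x $ j / (2 * pi) + of_int (k $ j)" for j
    by (simp add: field_simps)
  then show ?thesis
    by (simp add: torus_reduce_def torus_lattice_def vec_eq_iff algebra_simps)
qed

lemma torus_periodic_comp_reduce: "torus_periodic (\<lambda>x. F (torus_reduce x))"
  unfolding torus_periodic_def torus_lattice_def[symmetric] by (simp add: torus_reduce_lattice)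

lemma borel_measurable_torus_reduce [measurable]: "torus_reduce \<in> borel_measurable borel"
  by (intro borel_measurable_vecI) (simp add: torus_reduce_def)

lemma torus_cell_borel [measurable]: "torus_cell \<in> sets borel"
  unfolding torus_cell_def by measurable

text \<open>A Borel counterpart of \<open>torus_measure\<close> living on all of
  \<open>UNIV\<close>, so that measurability, Fubini and translations are handled on the whole space
  with Borel sets. \<open>distr_torus_measure\<close> connects the two.\<close>

definition tor :: "(real ^ 'd) measure" where
  "tor = density lborel (\<lambda>x. ennreal (1 / (2 * pi) ^ CARD('d)) * indicator torus_cell x)"

lemma sets_tor [measurable_cong, simp]: "sets tor = sets borel"
  by (simp add: tor_def)

lemma space_tor [simp]: "space tor = UNIV"
  by (simp add: tor_def)

lemma nn_integral_tor:
  fixes F :: "real ^ 'd \<Rightarrow> ennreal"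
  assumes [measurable]: "F \<in> borel_measurable borel"
  shows "(\<integral>\<^sup>+x. F x \<partial>tor) = ennreal (1 / (2 * pi) ^ CARD('d)) * (\<integral>\<^sup>+x. indicator torus_cell x * F x \<partial>lborel)"
  unfolding tor_def
  by (subst nn_integral_density) (simp_all add: nn_integral_cmult[symmetric] mult.assoc)

lemma nn_integral_tor_prod:
  fixes g :: "'d::finite \<Rightarrow> real \<Rightarrow> ennreal"
  assumes [measurable]: "\<And>j. g j \<in> borel_measurable borel"
  shows "(\<integral>\<^sup>+x. (\<Prod>j\<in>UNIV. g j (x $ j)) \<partial>(tor :: (real ^ 'd) measure))
     = (\<Prod>j\<in>UNIV. ennreal (1 / (2 * pi)) * (\<integral>\<^sup>+t. indicator {0..<2*pi} t * g j t \<partial>lborel))"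
proof -
  have ind: "indicator torus_cell x * (\<Prod>j\<in>UNIV. g j (x $ j)) = (\<Prod>j\<in>UNIV. indicator {0..<2*pi} (x $ j) * g j (x $ j))"
    for x :: "real ^ 'd"
    by (auto simp: torus_cell_def prod.distrib indicator_def not_le not_less intro!: exI)
  have m: "(\<lambda>t. indicator {0..<2*pi} t * g j t) \<in> borel_measurable borel" for j
    by measurable
  have "(\<integral>\<^sup>+x. (\<Prod>j\<in>UNIV. g j (x $ j)) \<partial>(tor :: (real ^ 'd) measure))
     = ennreal (1 / (2 * pi) ^ CARD('d)) * (\<Prod>j\<in>UNIV. \<integral>\<^sup>+t. indicator {0..<2*pi} t * g j t \<partial>lborel)"
    by (subst nn_integral_tor) (simp_all add: ind nn_integral_lborel_vec_prod[OF m, symmetric])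
  also have "ennreal (1 / (2 * pi) ^ CARD('d)) = (\<Prod>j\<in>(UNIV::'d set). ennreal (1 / (2 * pi)))"
    by (simp add: ennreal_power power_divide)
  finally show ?thesis
    by (simp add: prod.distrib)
qed

lemma emeasure_tor_UNIV: "emeasure (tor :: (real ^ 'd) measure) UNIV = 1"
proof -
  have "emeasure (tor :: (real ^ 'd) measure) UNIV = (\<integral>\<^sup>+x. (\<Prod>j\<in>(UNIV::'d set). (\<lambda>_ _. 1) j (x $ j)) \<partial>(tor :: (real ^ 'd) measure))"
    by simp
  also have "\<dots> = (\<Prod>j\<in>(UNIV::'d set). ennreal (1 / (2 * pi)) * (\<integral>\<^sup>+t. indicator {0..<2*pi} t * 1 \<partial>lborel))"
    by (subst nn_integral_tor_prod) auto
  also have "\<dots> = 1"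
    by (simp add: ennreal_mult[symmetric])
  finally show ?thesis .
qed

global_interpretation tor: prob_space "tor :: (real ^ 'd) measure"
  by standard (simp add: emeasure_tor_UNIV)

text \<open>Unfolding: the translates of the cell partition the space, so an integral over the
  shifted cell is a sum over lattice translates. Shifting each piece back leaves the periodic
  integrand unchanged and reassembles the integral over the cell itself.\<close>

lemma distr_tor_translate: "distr tor borel (\<lambda>x. torus_reduce (x + h)) = tor"
proof (rule measure_eqI)
  fix S assume "S \<in> sets (distr tor borel (\<lambda>x. torus_reduce (x + h)))"
  then have S [measurable]: "S \<in> sets borel" by simp
  define c where "c = ennreal (1 / (2 * pi) ^ CARD('a))"
  define G :: "real ^ 'a \<Rightarrow> ennreal" where "G x = indicator S (torus_reduce x)" for x
  have G [measurable]: "G \<in> borel_measurable borel"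
    unfolding G_def by measurable
  have Gper: "G (x + torus_lattice k) = G x" for x k
    by (simp add: G_def torus_reduce_lattice)
  have cell1: "(\<integral>\<^sup>+k. indicator torus_cell (y + torus_lattice k) \<partial>count_space UNIV) = (1::ennreal)" for y :: "real ^ 'a"
  proof -
    have "(\<integral>\<^sup>+k. indicator torus_cell (y + torus_lattice k) \<partial>count_space UNIV)
      = (\<integral>\<^sup>+k. indicator {\<chi> j. - \<lfloor>y $ j / (2 * pi)\<rfloor>} k \<partial>count_space UNIV)"
      by (intro nn_integral_cong) (auto simp: indicator_def torus_cell_lattice_iff)
    also have "\<dots> = 1" by simp
    finally show ?thesis .
  qed
  have pull: "(\<integral>\<^sup>+k. a * F k * b \<partial>count_space UNIV) = a * (\<integral>\<^sup>+k. F k \<partial>count_space UNIV) * b" 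
    for a b :: ennreal and F :: "int ^ 'a \<Rightarrow> ennreal"
    by (simp add: nn_integral_cmult nn_integral_multc)
  have "emeasure (distr tor borel (\<lambda>x. torus_reduce (x + h))) S = (\<integral>\<^sup>+x. G (x + h) \<partial>tor)"
    unfolding G_def
    by (subst nn_integral_indicator[symmetric], simp, subst nn_integral_distr) auto
  also have "\<dots> = c * (\<integral>\<^sup>+x. indicator torus_cell x * G (x + h) \<partial>lborel)"
    unfolding c_def by (rule nn_integral_tor) measurable
  also have "(\<integral>\<^sup>+x. indicator torus_cell x * G (x + h) \<partial>lborel) 
      = (\<integral>\<^sup>+x. indicator torus_cell (x - h) * G x \<partial>(distr lborel borel ((+) h)))"
    by (subst nn_integral_distr) (auto simp: add.commute)
  also have "\<dots> = (\<integral>\<^sup>+x. indicator torus_cell (x - h) * G x \<partial>lborel)"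
    by (simp add: lborel_distr_plus)
  \<comment> \<open>Inserts the factor one in the form of the lattice sum \<open>cell1\<close> at
    \<open>x\<close>, so that the sum over \<open>k\<close> can be pulled in front of the
    integral.\<close>
  also have "\<dots> = (\<integral>\<^sup>+x. (\<integral>\<^sup>+k. indicator torus_cell (x - h) * indicator torus_cell (x + torus_lattice k) * G x \<partial>count_space UNIV) \<partial>lborel)"
    by (subst pull) (simp add: cell1)
  also have "\<dots> = (\<integral>\<^sup>+k. (\<integral>\<^sup>+x. indicator torus_cell (x - h) * indicator torus_cell (x + torus_lattice k) * G x \<partial>lborel) \<partial>count_space UNIV)"
    by (rule nn_integral_count_space_nn_integral) auto
  also have "\<dots> = (\<integral>\<^sup>+k. (\<integral>\<^sup>+x. indicator torus_cell (x - h + torus_lattice (- k)) * indicator torus_cell x * G x \<partial>lborel) \<partial>count_space UNIV)"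
  proof (rule nn_integral_cong)
    fix k :: "int ^ 'a"
    have neg: "torus_lattice (- k) = - torus_lattice k" by (simp add: torus_lattice_def vec_eq_iff)
    have "(\<integral>\<^sup>+x. indicator torus_cell (x - h + torus_lattice (- k)) * indicator torus_cell x * G x \<partial>lborel)
      = (\<integral>\<^sup>+x. indicator torus_cell (x - h + torus_lattice (- k)) * indicator torus_cell x * G x \<partial>(distr lborel borel ((+) (torus_lattice k))))"
      by (simp add: lborel_distr_plus)
    also have "\<dots> = (\<integral>\<^sup>+x. indicator torus_cell (x - h) * indicator torus_cell (x + torus_lattice k) * G x \<partial>lborel)"
      by (subst nn_integral_distr) (auto simp: neg add.commute[of "torus_lattice k"] Gper algebra_simps)
    finally show "(\<integral>\<^sup>+x. indicator torus_cell (x - h) * indicator torus_cell (x + torus_lattice k) * G x \<partial>lborel) = 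
       (\<integral>\<^sup>+x. indicator torus_cell (x - h + torus_lattice (- k)) * indicator torus_cell x * G x \<partial>lborel)" ..
  qed
  also have "\<dots> = (\<integral>\<^sup>+x. (\<integral>\<^sup>+k. indicator torus_cell (x - h + torus_lattice (- k)) * indicator torus_cell x * G x \<partial>count_space UNIV) \<partial>lborel)"
    by (rule nn_integral_count_space_nn_integral[symmetric]) auto
  also have "\<dots> = (\<integral>\<^sup>+x. indicator torus_cell x * G x \<partial>lborel)"
  proof (rule nn_integral_cong)
    \<comment> \<open>The shifted pieces carry \<open>- k\<close>; negation permutes the lattice, so
      \<open>cell1\<close> applies again, now at \<open>x - h\<close>.\<close>
    fix x :: "real ^ 'a"
    have "(\<integral>\<^sup>+k. indicator torus_cell (x - h + torus_lattice (- k)) \<partial>count_space UNIV)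
        = (\<integral>\<^sup>+k. indicator torus_cell (x - h + torus_lattice k) \<partial>count_space UNIV :: ennreal)"
      by (rule nn_integral_bij_count_space) (auto intro: bij_uminus)
    then show "(\<integral>\<^sup>+k. indicator torus_cell (x - h + torus_lattice (- k)) * indicator torus_cell x * G x \<partial>count_space UNIV) = indicator torus_cell x * G x"
      using pull[of 1 "\<lambda>k. indicator torus_cell (x - h + torus_lattice (- k))" "indicator torus_cell x * G x"] cell1[of "x - h"] by (simp add: mult.assoc)
  qed
  also have "c * \<dots> = (\<integral>\<^sup>+x. G x \<partial>tor)"
    unfolding c_def by (rule nn_integral_tor[symmetric]) measurable
  also have "\<dots> = (\<integral>\<^sup>+x. indicator S x \<partial>tor)"
  proof -
    have "indicator torus_cell x * G x = indicator torus_cell x * indicator S x" for x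
      by (auto simp: G_def indicator_def torus_reduce_id)
    then show ?thesis by (subst (1 2) nn_integral_tor) auto
  qed
  also have "\<dots> = emeasure tor S" by simp
  finally show "emeasure (distr tor borel (\<lambda>x. torus_reduce (x + h))) S = emeasure tor S" .
qed simp

lemma nn_integral_tor_translate:
  fixes F :: "real ^ 'd \<Rightarrow> ennreal"
  assumes [measurable]: "F \<in> borel_measurable borel" and per: "torus_periodic F"
  shows "(\<integral>\<^sup>+x. F (x + h) \<partial>tor) = (\<integral>\<^sup>+x. F x \<partial>tor)"
proof -
  have "(\<integral>\<^sup>+x. F x \<partial>tor) = (\<integral>\<^sup>+x. F x \<partial>(distr tor borel (\<lambda>x. torus_reduce (x + h))))"
    by (simp add: distr_tor_translate)
  also have "\<dots> = (\<integral>\<^sup>+x. F (x + h) \<partial>tor)"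
    by (subst nn_integral_distr) (auto simp: torus_periodic_reduce[OF per])
  finally show ?thesis ..
qed

lemma integral_tor_translate:
  fixes F :: "real ^ 'd \<Rightarrow> 'b::{banach, second_countable_topology}"
  assumes [measurable]: "F \<in> borel_measurable borel" and per: "torus_periodic F"
  shows "(\<integral>x. F (x + h) \<partial>tor) = (\<integral>x. F x \<partial>tor)"
proof -
  have "(\<integral>x. F x \<partial>tor) = (\<integral>x. F x \<partial>(distr tor borel (\<lambda>x. torus_reduce (x + h))))"
    by (simp add: distr_tor_translate)
  also have "\<dots> = (\<integral>x. F (x + h) \<partial>tor)"
    by (subst integral_distr) (auto simp: torus_periodic_reduce[OF per])
  finally show ?thesis ..
qed

lemma integrable_tor_translate:
  fixes F :: "real ^ 'd \<Rightarrow> 'b::{banach, second_countable_topology}"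
  assumes [measurable]: "F \<in> borel_measurable borel" and per: "torus_periodic F"
  shows "integrable tor (\<lambda>x. F (x + h)) \<longleftrightarrow> integrable tor F"
proof -
  have "integrable tor F \<longleftrightarrow> integrable (distr tor borel (\<lambda>x. torus_reduce (x + h))) F"
    by (simp add: distr_tor_translate)
  also have "\<dots> \<longleftrightarrow> integrable tor (\<lambda>x. F (x + h))"
    by (subst integrable_distr_eq) (auto simp: torus_periodic_reduce[OF per])
  finally show ?thesis ..
qed

text \<open>Composing the predicate with \<open>torus_reduce\<close> makes it periodic; otherwise
  its values at points \<open>x + h\<close> outside the cell would be unrelated to those on
  it.\<close>

lemma AE_tor_translate:
  assumes "AE x in tor. P (torus_reduce x)"
  shows "AE x in tor. P (torus_reduce (x + h))"
proof -
  have "AE x in (distr tor borel (\<lambda>x. torus_reduce (x + h))). P (torus_reduce x)"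
    unfolding distr_tor_translate by (rule assms)
  then have "AE x in tor. P (torus_reduce (torus_reduce (x + h)))"
    by (rule AE_distrD[rotated]) simp
  then show ?thesis by (simp add: torus_reduce_id torus_reduce_cell)
qed

section \<open>Characters and Dirichlet kernels\<close>

lemma torus_character_add_point: "torus_character k (x + y) = torus_character k x * torus_character k y"
  by (simp add: torus_character_def exp_add[symmetric] algebra_simps sum.distrib)

lemma torus_character_add: "torus_character (k + l) x = torus_character k x * torus_character l x"
  by (simp add: torus_character_def exp_add[symmetric] algebra_simps sum.distrib)

lemma torus_character_uminus: "torus_character (- k) x = cnj (torus_character k x)"
  by (simp add: torus_character_def exp_cnj sum_negf)

lemma torus_character_uminus_point: "torus_character k (- x) = cnj (torus_character k x)"
  by (simp add: torus_character_def exp_cnj sum_negf)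

lemma torus_character_diff: "torus_character (k - l) x = torus_character k x * cnj (torus_character l x)"
  using torus_character_add[of k "- l" x] by (simp add: torus_character_uminus)

lemma torus_character_diff_point: "torus_character k (x - y) = torus_character k x * cnj (torus_character k y)"
  using torus_character_add_point[of k x "- y"] by (simp add: torus_character_uminus_point)

lemma torus_character_0 [simp]: "torus_character 0 x = 1" "torus_character k 0 = 1"
  by (simp_all add: torus_character_def)

lemma norm_torus_character [simp]: "norm (torus_character k x) = 1"
  by (simp add: torus_character_def)

lemma torus_character_mult_cnj [simp]: "torus_character k x * cnj (torus_character k x) = 1"
  using torus_character_diff[of k k x] by simp

lemma torus_character_eq_prod: "torus_character k x = (\<Prod>j\<in>UNIV. cis (of_int (k $ j) * x $ j))"
  by (simp add: torus_character_def cis_conv_exp exp_sum[symmetric] sum_distrib_left)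

lemma torus_periodic_character: "torus_periodic (torus_character k)"
proof -
  have "torus_character k (x + torus_lattice l) = torus_character k x" for x l
  proof -
    have "of_int (k $ j) * (2 * pi * of_int (l $ j)) = 2 * pi * of_int (k $ j * l $ j)" for j
      by simp
    then have "torus_character k (torus_lattice l) = 1"
      by (simp only: torus_character_eq_prod torus_lattice_def vec_lambda_beta) (simp add: cis_multiple_2pi)
    then show ?thesis by (simp add: torus_character_add_point)
  qed
  then show ?thesis by (simp add: torus_periodic_def torus_lattice_def)
qed

lemma continuous_torus_character: "continuous_on S (torus_character k)"
  unfolding torus_character_def by (intro continuous_intros)

lemma borel_measurable_torus_character [measurable]: "torus_character k \<in> borel_measurable borel"
  by (intro borel_measurable_continuous_onI continuous_torus_character)

lemma integrable_tor_bounded: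
  fixes F :: "real ^ 'd \<Rightarrow> 'b::{banach, second_countable_topology}"
  assumes "F \<in> borel_measurable borel" "\<And>x. norm (F x) \<le> C"
  shows "integrable tor F"
  using assms by (intro tor.integrable_const_bound[of _ C]) auto

lemma integrable_torus_character: "integrable tor (torus_character k)"
  by (rule integrable_tor_bounded[of _ 1]) auto

lemma integral_torus_character: "(\<integral>x. torus_character k x \<partial>tor) = of_bool (k = 0)"
proof (cases "k = 0")
  case True
  then show ?thesis by (simp add: tor.prob_space[unfolded space_tor])
next
  case False
  then obtain j where j: "k $ j \<noteq> 0" by (auto simp: vec_eq_iff)
  \<comment> \<open>With this shift the phase of the character is pi, so its value is -1, and
    translation invariance makes the integral equal to its own negative.\<close>
  define h :: "real ^ 'a" where "h = axis j (pi / of_int (k $ j))"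
  have "(\<Sum>i\<in>UNIV. of_int (k $ i) * h $ i) = pi"
    using j by (simp add: h_def axis_def if_distrib[of "(*) _"] cong: if_cong)
  then have h: "torus_character k h = -1"
    by (simp add: torus_character_def)
  have "(\<integral>x. torus_character k x \<partial>tor) = (\<integral>x. torus_character k (x + h) \<partial>tor)"
    by (rule integral_tor_translate[symmetric]) (auto simp: torus_periodic_character)
  also have "\<dots> = - (\<integral>x. torus_character k x \<partial>tor)"
    by (simp add: torus_character_add_point h)
  finally show ?thesis using False by simp
qed

section \<open>Frequency boxes, Dirichlet kernels and their common majorant\<close>

lemma box_eq_image: "{k :: 'a ^ 'd. \<forall>j. k $ j \<in> A j} = vec_lambda ` (PiE UNIV A)"
proof -
  have "k = vec_lambda (vec_nth k)" for k :: "'a ^ 'd" by simp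
  then show ?thesis by (force simp: image_iff)
qed

lemma sum_box_prod:
  fixes F :: "'d::finite \<Rightarrow> 'a \<Rightarrow> 'b::comm_semiring_1"
  assumes "\<And>j. finite (A j)"
  shows "(\<Sum>k\<in>{k :: 'a ^ 'd. \<forall>j. k $ j \<in> A j}. \<Prod>j\<in>UNIV. F j (k $ j)) = (\<Prod>j\<in>UNIV. \<Sum>a\<in>A j. F j a)"
proof -
  have inj: "inj_on vec_lambda (PiE UNIV A)" by (auto simp: inj_on_def vec_lambda_inject)
  show ?thesis
    unfolding box_eq_image
    by (subst sum.reindex[OF inj], subst prod_sum_PiE) (use assms in auto)
qed

lemma finite_box: "(\<And>j. finite (A j)) \<Longrightarrow> finite {k :: 'a ^ 'd. \<forall>j. k $ j \<in> A j}"
  unfolding box_eq_image by (intro finite_imageI finite_PiE) auto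

lemma card_box:
  assumes "\<And>j. finite (A j)"
  shows "card {k :: 'a ^ 'd. \<forall>j. k $ j \<in> A j} = (\<Prod>j\<in>UNIV. card (A j))"
  using sum_box_prod[of A "\<lambda>_ _. 1 :: nat"] assms by simp

lemma rect_frequencies_eq_box: "rect_frequencies n = {k. \<forall>j. k $ j \<in> {- int (n $ j)..int (n $ j)}}"
  by (auto simp: rect_frequencies_def abs_le_iff minus_le_iff)

definition dirichlet_kernel :: "nat ^ 'd \<Rightarrow> real ^ 'd \<Rightarrow> complex" where
  "dirichlet_kernel n x = (\<Sum>k\<in>rect_frequencies n. torus_character k x)"

lemma dirichlet_kernel_eq_prod:
  "dirichlet_kernel n x = (\<Prod>j\<in>UNIV. \<Sum>a\<in>{- int (n $ j)..int (n $ j)}. cis (of_int a * x $ j))"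
  unfolding dirichlet_kernel_def rect_frequencies_eq_box torus_character_eq_prod
  by (rule sum_box_prod) auto

text \<open>Closed form of the one-dimensional Dirichlet kernel, multiplied out by 2i sin(t/2) so
  that zeros of the sine are no special case. The terms added in each step telescope by the
  product-to-sum identity \<open>key\<close>.\<close>

lemma sum_cis_telescope:
  "(\<Sum>a\<in>{- int n..int n}. cis (of_int a * t)) * (cis (t / 2) - cis (- (t / 2)))
     = cis ((real n + 1 / 2) * t) - cis (- ((real n + 1 / 2) * t))"
proof (induction n)
  case 0
  then show ?case by simp
next
  case (Suc n)
  have "{- int (Suc n)..int (Suc n)} = insert (- int (Suc n)) (insert (int (Suc n)) {- int n..int n})"
    by auto
  then have "(\<Sum>a\<in>{- int (Suc n)..int (Suc n)}. cis (of_int a * t))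
    = cis (of_int (- int (Suc n)) * t) + (cis (of_int (int (Suc n)) * t) + (\<Sum>a\<in>{- int n..int n}. cis (of_int a * t)))"
    by simp
  then have "(\<Sum>a\<in>{- int (Suc n)..int (Suc n)}. cis (of_int a * t)) * (cis (t / 2) - cis (- (t / 2)))
    = (cis (- (real (Suc n) * t)) + cis (real (Suc n) * t)) * (cis (t / 2) - cis (- (t / 2)))
      + (cis ((real n + 1 / 2) * t) - cis (- ((real n + 1 / 2) * t)))"
    unfolding Suc.IH[symmetric] by (simp add: algebra_simps)
  moreover have key: "(cis (- b) + cis b) * (cis a - cis (- a)) = cis (b + a) - cis (- (b + a)) - (cis (b - a) - cis (- (b - a)))" for a b
    by (simp add: complex_eq_iff sin_add cos_add sin_diff cos_diff algebra_simps)
  have arg: "real (Suc n) * t + t / 2 = (real (Suc n) + 1 / 2) * t" "real (Suc n) * t - t / 2 = (real n + 1 / 2) * t"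
    by (simp_all add: algebra_simps)
  ultimately show ?case
    using key[of "real (Suc n) * t" "t / 2"] unfolding arg by (metis diff_add_cancel)
qed

lemma norm_sum_cis_sin: "norm (\<Sum>a\<in>{- int n..int n}. cis (of_int a * t)) * \<bar>sin (t / 2)\<bar> \<le> 1"
proof -
  have d: "cis u - cis (- u) = 2 * \<i> * sin u" for u
    by (simp add: complex_eq_iff)
  have "norm (\<Sum>a\<in>{- int n..int n}. cis (of_int a * t)) * norm (2 * \<i> * sin (t / 2)) = norm (2 * \<i> * sin ((real n + 1 / 2) * t))"
    unfolding d[symmetric] norm_mult[symmetric] using sum_cis_telescope[where n = n and t = t] by simp
  also have "\<dots> \<le> 2" by (simp add: norm_mult)
  finally show ?thesis by (simp add: norm_mult)
qed

text \<open>The harmonic mean of the two classical bounds 2N + 1 and 1 / |sin(t/2)| for the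
  Dirichlet kernel, hence at most twice their minimum: one formula without case split that dominates
  the kernels of all degrees up to \<open>N\<close>.\<close>

definition dirichlet_majorant :: "nat \<Rightarrow> real \<Rightarrow> real" where
  "dirichlet_majorant N t = 2 / (1 / (2 * real N + 1) + \<bar>sin (t / 2)\<bar>)"

lemma dirichlet_majorant_denom_pos: "1 / (2 * real N + 1) + \<bar>s\<bar> > 0"
  by (intro add_pos_nonneg) auto

lemma dirichlet_majorant_pos: "dirichlet_majorant N t > 0"
  unfolding dirichlet_majorant_def using dirichlet_majorant_denom_pos by simp

text \<open>Each classical bound says that the norm times one summand of the denominator is at most
  one; adding the two produces the 2 in the majorant.\<close>

lemma norm_sum_cis_le:
  assumes "n \<le> N"
  shows "norm (\<Sum>a\<in>{- int n..int n}. cis (of_int a * t)) \<le> dirichlet_majorant N t"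
proof -
  let ?D = "norm (\<Sum>a\<in>{- int n..int n}. cis (of_int a * t))"
  have "?D \<le> (\<Sum>a\<in>{- int n..int n}. 1)"
    by (rule order_trans[OF norm_sum]) simp
  also have "\<dots> \<le> 2 * real N + 1" using assms by simp
  finally have h: "?D / (2 * real N + 1) \<le> 1" by simp
  have "?D * (1 / (2 * real N + 1) + \<bar>sin (t / 2)\<bar>) = ?D / (2 * real N + 1) + ?D * \<bar>sin (t / 2)\<bar>"
    by (simp add: distrib_left)
  with h norm_sum_cis_sin[where n = n and t = t] have "?D * (1 / (2 * real N + 1) + \<bar>sin (t / 2)\<bar>) \<le> 2"
    by linarith
  then show ?thesis
    unfolding dirichlet_majorant_def by (subst pos_le_divide_eq[OF dirichlet_majorant_denom_pos])
qed

lemma norm_dirichlet_kernel_le: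
  assumes "\<And>j. n $ j \<le> N"
  shows "norm (dirichlet_kernel n x) \<le> (\<Prod>j\<in>UNIV. dirichlet_majorant N (x $ j))"
  unfolding dirichlet_kernel_eq_prod prod_norm[symmetric]
  by (intro prod_mono conjI norm_sum_cis_le assms) auto

text \<open>Jordan's inequality: the concave sine lies above its chord from 0 to pi / 2.\<close>

lemma sin_ge_linear:
  assumes "0 \<le> u" "u \<le> pi / 2"
  shows "2 * u / pi \<le> sin u"
proof -
  have "concave_on {0..pi} sin"
    by (rule f''_le0_imp_concave[where f' = cos and f'' = "\<lambda>x. - sin x"])
       (auto intro!: derivative_eq_intros sin_ge_zero)
  then have c: "convex_on {0..pi} (\<lambda>x. - sin x)" by (simp add: concave_on_def)
  have "- sin ((1 - 2 * u / pi) *\<^sub>R 0 + (2 * u / pi) *\<^sub>R (pi / 2)) \<le> (1 - 2 * u / pi) * (- sin 0) + (2 * u / pi) * (- sin (pi / 2))"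
    using assms by (intro convex_onD[OF c]) (auto simp: field_simps)
  then show ?thesis by simp
qed

lemma abs_sin_add_int_pi: "\<bar>sin (x + pi * of_int k)\<bar> = \<bar>sin x\<bar>"
proof -
  have "cos (pi * of_int k) ^ 2 = 1" using sin_cos_squared_add[of "pi * of_int k"] by (simp add: sin_integer_2pi sin_zero_iff_int2 mult.commute)
  then have "\<bar>cos (pi * of_int k)\<bar> = 1" by (simp add: abs_square_eq_1)
  moreover have "sin (pi * of_int k) = 0" by (simp add: sin_zero_iff_int2 mult.commute)
  ultimately show ?thesis by (simp add: sin_add abs_mult)
qed

text \<open>Turns the distance to the lattice into a sine, whose square the Fejer kernel integrates
  exactly.\<close>

lemma circle_abs_le_sin: "circle_abs t \<le> pi * \<bar>sin (t / 2)\<bar>"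
proof -
  \<comment> \<open>Rounding selects the nearest lattice point, so the remainder \<open>s\<close>
    has absolute value at most pi and the chord bound applies to half of it.\<close>
  define k where "k = round (t / (2 * pi))"
  define s where "s = t - 2 * pi * of_int k"
  have "\<bar>of_int k - t / (2 * pi)\<bar> \<le> 1 / 2" unfolding k_def by (rule of_int_round_abs_le)
  then have "\<bar>of_int k - t / (2 * pi)\<bar> * (2 * pi) \<le> pi" by simp
  also have "\<bar>of_int k - t / (2 * pi)\<bar> * (2 * pi) = \<bar>(of_int k - t / (2 * pi)) * (2 * pi)\<bar>"
    by (simp add: abs_mult)
  also have "(of_int k - t / (2 * pi)) * (2 * pi) = - s" by (simp add: s_def field_simps)
  finally have s: "\<bar>s\<bar> \<le> pi" by simp
  have "circle_abs t \<le> dist t (2 * pi * of_int k)"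
    unfolding circle_abs_def by (rule infdist_le) auto
  also have "\<dots> = \<bar>s\<bar>" by (simp add: s_def dist_real_def)
  also have "\<dots> \<le> pi * sin (\<bar>s\<bar> / 2)"
    using sin_ge_linear[of "\<bar>s\<bar> / 2"] s by (simp add: field_simps)
  also have "sin (\<bar>s\<bar> / 2) = \<bar>sin (s / 2)\<bar>"
    using s sin_ge_zero[of "\<bar>s\<bar> / 2"] by (cases "s \<ge> 0") auto
  also have "\<bar>sin (s / 2)\<bar> = \<bar>sin (t / 2)\<bar>"
    using abs_sin_add_int_pi[of "s / 2" k] by (simp add: s_def diff_divide_distrib)
  finally show ?thesis .
qed

lemma dirichlet_majorant_periodic: "dirichlet_majorant N (t + 2 * pi * of_int k) = dirichlet_majorant N t"
  using abs_sin_add_int_pi[of "t / 2" k] by (simp add: dirichlet_majorant_def add_divide_distrib)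

lemma borel_measurable_dirichlet_majorant [measurable]: "dirichlet_majorant N \<in> borel_measurable borel"
  unfolding dirichlet_majorant_def by measurable

section \<open>Logarithmic bound for the integral of the majorant\<close>

lemma nn_integral_reciprocal_linear:
  assumes "\<epsilon> > 0"
  shows "(\<integral>\<^sup>+t. ennreal (2 / (\<epsilon> + t / pi)) * indicator {0..2*pi} t \<partial>lborel) = ennreal (2 * pi * ln (1 + 2 / \<epsilon>))"
    and "(\<integral>\<^sup>+t. ennreal (2 / (\<epsilon> + (2 * pi - t) / pi)) * indicator {0..2*pi} t \<partial>lborel) = ennreal (2 * pi * ln (1 + 2 / \<epsilon>))"
proof -
  have ln: "ln (\<epsilon> + 2) - ln \<epsilon> = ln (1 + 2 / \<epsilon>)"
  proof -
    have "1 + 2 / \<epsilon> = (\<epsilon> + 2) / \<epsilon>" using assms by (simp add: field_simps)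
    then show ?thesis using assms by (simp add: ln_div)
  qed
  have "(\<integral>\<^sup>+t. ennreal (2 / (\<epsilon> + t / pi)) * indicator {0..2*pi} t \<partial>lborel)
     = ennreal (2 * pi * ln (\<epsilon> + 2 * pi / pi) - 2 * pi * ln (\<epsilon> + 0 / pi))"
  proof (rule nn_integral_FTC_Icc)
    fix t :: real assume t: "t \<in> {0..2*pi}"
    then have p: "\<epsilon> + t / pi > 0" using assms by (intro add_pos_nonneg) auto
    then show "0 \<le> 2 / (\<epsilon> + t / pi)" by simp
    show "((\<lambda>t. 2 * pi * ln (\<epsilon> + t / pi)) has_real_derivative 2 / (\<epsilon> + t / pi)) (at t)"
      using p by (auto intro!: derivative_eq_intros)
  qed auto
  then show "(\<integral>\<^sup>+t. ennreal (2 / (\<epsilon> + t / pi)) * indicator {0..2*pi} t \<partial>lborel) = ennreal (2 * pi * ln (1 + 2 / \<epsilon>))"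
    using ln by (simp add: right_diff_distrib[symmetric])
  have "(\<integral>\<^sup>+t. ennreal (2 / (\<epsilon> + (2 * pi - t) / pi)) * indicator {0..2*pi} t \<partial>lborel)
     = ennreal (- (2 * pi * ln (\<epsilon> + (2 * pi - 2 * pi) / pi)) - - (2 * pi * ln (\<epsilon> + (2 * pi - 0) / pi)))"
  proof (rule nn_integral_FTC_Icc)
    fix t :: real assume t: "t \<in> {0..2*pi}"
    then have p: "\<epsilon> + (2 * pi - t) / pi > 0" using assms by (intro add_pos_nonneg) auto
    then show "0 \<le> 2 / (\<epsilon> + (2 * pi - t) / pi)" by simp
    show "((\<lambda>t. - (2 * pi * ln (\<epsilon> + (2 * pi - t) / pi))) has_real_derivative 2 / (\<epsilon> + (2 * pi - t) / pi)) (at t)"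
      using p by (auto intro!: derivative_eq_intros)
  qed auto
  then show "(\<integral>\<^sup>+t. ennreal (2 / (\<epsilon> + (2 * pi - t) / pi)) * indicator {0..2*pi} t \<partial>lborel) = ennreal (2 * pi * ln (1 + 2 / \<epsilon>))"
    using ln by (simp add: right_diff_distrib[symmetric])
qed

lemma nn_integral_dirichlet_majorant:
  "ennreal (1 / (2 * pi)) * (\<integral>\<^sup>+t. indicator {0..<2*pi} t * ennreal (dirichlet_majorant N t) \<partial>lborel)
     \<le> ennreal (2 * ln (4 * real N + 3))"
proof -
  define \<epsilon> where "\<epsilon> = 1 / (2 * real N + 1)"
  have \<epsilon>: "\<epsilon> > 0" by (simp add: \<epsilon>_def)
  have le: "dirichlet_majorant N t \<le> 2 / (\<epsilon> + t / pi) + 2 / (\<epsilon> + (2 * pi - t) / pi)" if "0 \<le> t" "t \<le> 2 * pi" for t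
  proof -
    have p: "\<epsilon> + t / pi > 0" "\<epsilon> + (2 * pi - t) / pi > 0" using \<epsilon> that by (auto intro!: add_pos_nonneg)
    \<comment> \<open>The chord bound controls the sine from the nearer end of the period, 0 or 2
      pi; the sum of both reciprocals covers either case.\<close>
    have "t / pi \<le> \<bar>sin (t / 2)\<bar> \<or> (2 * pi - t) / pi \<le> \<bar>sin (t / 2)\<bar>"
    proof (cases "t \<le> pi")
      case True
      then show ?thesis using sin_ge_linear[of "t / 2"] that by auto
    next
      case False
      have "sin (pi - t / 2) = sin (t / 2)" by simp
      then show ?thesis using sin_ge_linear[of "pi - t / 2"] that False by (auto simp: right_diff_distrib)
    qed
    then show ?thesis
    proof
      assume "t / pi \<le> \<bar>sin (t / 2)\<bar>"
      then have "dirichlet_majorant N t \<le> 2 / (\<epsilon> + t / pi)"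
        unfolding dirichlet_majorant_def \<epsilon>_def[symmetric] using p by (intro divide_left_mono) auto
      then show ?thesis using p by (smt (verit) divide_nonneg_pos)
    next
      assume "(2 * pi - t) / pi \<le> \<bar>sin (t / 2)\<bar>"
      then have "dirichlet_majorant N t \<le> 2 / (\<epsilon> + (2 * pi - t) / pi)"
        unfolding dirichlet_majorant_def \<epsilon>_def[symmetric] using p by (intro divide_left_mono) auto
      then show ?thesis using p by (smt (verit) divide_nonneg_pos)
    qed
  qed
  have "(\<integral>\<^sup>+t. indicator {0..<2*pi} t * ennreal (dirichlet_majorant N t) \<partial>lborel)
    \<le> (\<integral>\<^sup>+t. ennreal (2 / (\<epsilon> + t / pi)) * indicator {0..2*pi} t + ennreal (2 / (\<epsilon> + (2 * pi - t) / pi)) * indicator {0..2*pi} t \<partial>lborel)"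
  proof (intro nn_integral_mono)
    fix t :: real
    show "indicator {0..<2*pi} t * ennreal (dirichlet_majorant N t) \<le>
      ennreal (2 / (\<epsilon> + t / pi)) * indicator {0..2*pi} t + ennreal (2 / (\<epsilon> + (2 * pi - t) / pi)) * indicator {0..2*pi} t"
      using le[of t] \<epsilon> by (auto simp: indicator_def ennreal_plus[symmetric] simp del: ennreal_plus)
  qed
  also have "\<dots> = ennreal (2 * pi * ln (1 + 2 / \<epsilon>)) + ennreal (2 * pi * ln (1 + 2 / \<epsilon>))"
    by (subst nn_integral_add) (auto simp: nn_integral_reciprocal_linear \<epsilon>)
  \<comment> \<open>\<open>2 / \<epsilon>\<close> equals 4N + 2, which produces the argument 4N +
    3.\<close>
  also have "\<dots> = ennreal (4 * pi * ln (4 * real N + 3))"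
    by (simp add: \<epsilon>_def ennreal_plus[symmetric] algebra_simps del: ennreal_plus)
  finally have "ennreal (1 / (2 * pi)) * (\<integral>\<^sup>+t. indicator {0..<2*pi} t * ennreal (dirichlet_majorant N t) \<partial>lborel)
    \<le> ennreal (1 / (2 * pi)) * ennreal (4 * pi * ln (4 * real N + 3))"
    by (rule mult_left_mono) simp
  also have "\<dots> = ennreal (2 * ln (4 * real N + 3))"
    by (simp add: ennreal_mult[symmetric])
  finally show ?thesis .
qed

text \<open>The \<open>m\<close> of the overview. The \<open>itself\<close> argument supplies the
  dimension, which \<open>N\<close> does not determine.\<close>

definition kernel_bound :: "'d::finite itself \<Rightarrow> nat \<Rightarrow> real" where
  "kernel_bound _ N = (2 * ln (4 * real N + 3)) ^ CARD('d)"

lemma kernel_bound_pos: "kernel_bound TYPE('d::finite) N > 0"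
  by (simp add: kernel_bound_def)

lemma torus_periodic_majorant:
  "torus_periodic (\<lambda>x :: real ^ 'd. \<Prod>j\<in>UNIV. dirichlet_majorant N (x $ j))"
  by (simp add: torus_periodic_def dirichlet_majorant_periodic)

lemma majorant_nonneg: "0 \<le> (\<Prod>j\<in>UNIV. dirichlet_majorant N (x $ j))"
  by (intro prod_nonneg) (auto intro: less_imp_le dirichlet_majorant_pos)

text \<open>Translation invariance removes \<open>y\<close>, and the product form of the majorant
  gives the d-th power of the one-dimensional bound.\<close>

lemma nn_integral_majorant:
  "(\<integral>\<^sup>+x. ennreal (\<Prod>j\<in>UNIV. dirichlet_majorant N ((x - y) $ j)) \<partial>(tor :: (real ^ 'd) measure))
      \<le> ennreal (kernel_bound TYPE('d) N)"
proof -
  have "(\<integral>\<^sup>+x. ennreal (\<Prod>j\<in>UNIV. dirichlet_majorant N ((x - y) $ j)) \<partial>(tor :: (real ^ 'd) measure))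
    = (\<integral>\<^sup>+x. ennreal (\<Prod>j\<in>UNIV. dirichlet_majorant N (x $ j)) \<partial>(tor :: (real ^ 'd) measure))"
    using nn_integral_tor_translate[of "\<lambda>x. ennreal (\<Prod>j\<in>UNIV. dirichlet_majorant N (x $ j))" "- y"]
      torus_periodic_majorant[of N, where 'd = 'd]
    by (simp add: torus_periodic_def)
  also have "\<dots> = (\<integral>\<^sup>+x. (\<Prod>j\<in>UNIV. ennreal (dirichlet_majorant N (x $ j))) \<partial>(tor :: (real ^ 'd) measure))"
    by (simp add: prod_ennreal dirichlet_majorant_pos less_imp_le)
  also have "\<dots> \<le> (\<Prod>j\<in>(UNIV :: 'd set). ennreal (2 * ln (4 * real N + 3)))"
    by (subst nn_integral_tor_prod[where g = "\<lambda>_ t. ennreal (dirichlet_majorant N t)"])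
       (auto intro!: power_mono nn_integral_dirichlet_majorant)
  also have "\<dots> = ennreal (kernel_bound TYPE('d) N)"
    by (simp add: kernel_bound_def ennreal_power)
  finally show ?thesis .
qed

lemma integral_majorant:
  shows "integrable tor (\<lambda>x :: real ^ 'd. \<Prod>j\<in>UNIV. dirichlet_majorant N ((x - y) $ j))"
    and "(\<integral>x. (\<Prod>j\<in>UNIV. dirichlet_majorant N ((x - y) $ j)) \<partial>(tor :: (real ^ 'd) measure)) \<le> kernel_bound TYPE('d) N"
proof -
  let ?f = "\<lambda>x :: real ^ 'd. \<Prod>j\<in>UNIV. dirichlet_majorant N ((x - y) $ j)"
  have m: "?f \<in> borel_measurable tor" by measurable
  have le: "(\<integral>\<^sup>+x. ennreal (?f x) \<partial>tor) \<le> ennreal (kernel_bound TYPE('d) N)"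
    by (rule nn_integral_majorant)
  show i: "integrable tor ?f"
    using le by (intro integrableI_nonneg m) (auto intro!: majorant_nonneg[of _ "_ - y"] simp: less_top[symmetric] top_unique
        simp del: vector_minus_component)
  show "integral\<^sup>L tor ?f \<le> kernel_bound TYPE('d) N"
    using le nn_integral_eq_integral[OF i] majorant_nonneg[of N "_ - y"] kernel_bound_pos[of N, where 'd = 'd]
    by (simp add: less_imp_le)
qed

section \<open>A maximal inequality\<close>

text \<open>\<open>coef\<close> and \<open>psum\<close> are the counterparts of
  \<open>fourier_coeff\<close> and \<open>rect_partial_sum\<close> for \<open>tor\<close>; the final
  proof identifies them through a Borel representative.\<close>

definition coef :: "(real ^ 'd \<Rightarrow> complex) \<Rightarrow> int ^ 'd \<Rightarrow> complex" where
  "coef g k = (\<integral>x. g x * torus_character (- k) x \<partial>tor)"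

definition psum :: "nat ^ 'd \<Rightarrow> (real ^ 'd \<Rightarrow> complex) \<Rightarrow> real ^ 'd \<Rightarrow> complex" where
  "psum n g x = (\<Sum>k\<in>rect_frequencies n. coef g k * torus_character k x)"

definition cube_indices :: "nat \<Rightarrow> (nat ^ 'd) set" where
  "cube_indices N = {n. \<forall>j. n $ j \<le> N}"

lemma borel_measurable_cnj [measurable (raw)]:
  "f \<in> borel_measurable M \<Longrightarrow> (\<lambda>x. cnj (f x)) \<in> borel_measurable M"
  by (rule borel_measurable_continuous_on[of cnj]) (intro continuous_intros)

lemma finite_cube_indices [simp]: "finite (cube_indices N)"
  using finite_box[of "\<lambda>_. {..N}"] by (simp add: cube_indices_def)

lemma cube_indices_nonempty: "(\<chi> j. 0) \<in> cube_indices N"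
  by (simp add: cube_indices_def)

lemma rect_frequencies_Int: "rect_frequencies n \<inter> rect_frequencies n' = rect_frequencies (\<chi> j. min (n $ j) (n' $ j))"
  unfolding rect_frequencies_def by (auto simp: of_nat_min)

lemma rect_frequencies_cube: "n \<in> cube_indices N \<Longrightarrow> rect_frequencies n \<subseteq> rect_frequencies (\<chi> j. N)"
  unfolding rect_frequencies_def cube_indices_def by (auto intro: order_trans)

section \<open>Linearizing the maximal partial sum, and bounds for the adjoint\<close>

lemma norm_integral_le_kernel_bound:
  fixes F :: "real ^ 'd \<Rightarrow> complex"
  assumes "\<And>y. norm (F y) \<le> (\<Prod>j\<in>UNIV. dirichlet_majorant N ((y - x) $ j))"
  shows "norm (\<integral>y. F y \<partial>tor) \<le> kernel_bound TYPE('d) N"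
proof -
  have "norm (\<integral>y. F y \<partial>tor) \<le> (\<integral>y. norm (F y) \<partial>tor)"
    by (rule integral_norm_bound)
  also have "\<dots> \<le> (\<integral>y. (\<Prod>j\<in>UNIV. dirichlet_majorant N ((y - x) $ j)) \<partial>tor)"
    by (intro integral_mono' integral_majorant assms majorant_nonneg)
  also have "\<dots> \<le> kernel_bound TYPE('d) N"
    by (rule integral_majorant)
  finally show ?thesis .
qed

text \<open>Induction on the index set: the earlier choice is kept unless the new index is strictly
  better. Countability of the index type makes the selected value measurable at each stage.\<close>

lemma measurable_argmax_selector:
  fixes a :: "'i::countable \<Rightarrow> 'a \<Rightarrow> real"
  assumes "finite I" "I \<noteq> {}" and a [measurable]: "\<And>i. a i \<in> borel_measurable M"
  shows "\<exists>\<nu>. \<nu> \<in> measurable M (count_space UNIV) \<and> (\<forall>x. \<nu> x \<in> I \<and> (\<forall>i\<in>I. a i x \<le> a (\<nu> x) x))"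
  using assms(1,2)
proof (induction rule: finite_ne_induct)
  case (singleton i)
  then show ?case by (intro exI[of _ "\<lambda>_. i"]) auto
next
  case (insert i I)
  then obtain \<nu> where \<nu> [measurable]: "\<nu> \<in> measurable M (count_space UNIV)"
    and max: "\<And>x. \<nu> x \<in> I" "\<And>x i. i \<in> I \<Longrightarrow> a i x \<le> a (\<nu> x) x" by blast
  have [measurable]: "(\<lambda>x. a (\<nu> x) x) \<in> borel_measurable M"
    by (rule measurable_compose_countable[of "\<lambda>i. a i", OF a \<nu>])
  have "(\<lambda>x. if a (\<nu> x) x < a i x then i else \<nu> x) \<in> measurable M (count_space UNIV)"
    by measurable
  moreover have "(if a (\<nu> x) x < a i x then i else \<nu> x) \<in> insert i I \<and>
     (\<forall>k\<in>insert i I. a k x \<le> a (if a (\<nu> x) x < a i x then i else \<nu> x) x)" for x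
    using max(1)[of x] max(2)[of _ x] by (force intro: order_trans less_imp_le)
  ultimately show ?case by (intro exI[of _ "\<lambda>x. if a (\<nu> x) x < a i x then i else \<nu> x"]) blast
qed

lemma integrable_mult_character:
  assumes "integrable tor g"
  shows "integrable tor (\<lambda>x. g x * torus_character k x)"
proof (rule Bochner_Integration.integrable_bound[OF assms])
  have [measurable]: "g \<in> borel_measurable borel" using borel_measurable_integrable[OF assms] by simp
  show "(\<lambda>x. g x * torus_character k x) \<in> borel_measurable tor" by measurable
qed (simp add: norm_mult)

text \<open>The pointwise interpolation between p = 1 and p = 2. For a >= 1 the product is at most
  a, hence at most a^p; for smaller a it is at most the mean of the squares, and a^2 is at most
  a^p.\<close>

lemma mult_le_powr_plus_square:
  fixes a b p :: real
  assumes "0 \<le> a" "0 \<le> b" "b \<le> 1" "1 \<le> p" "p \<le> 2"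
  shows "a * b \<le> a powr p + b\<^sup>2"
proof (cases "a \<ge> 1")
  case True
  have "a * b \<le> a * 1" using assms by (intro mult_left_mono) auto
  also have "\<dots> \<le> a powr p" using powr_mono[of 1 p a] True assms by simp
  finally show ?thesis by (simp add: add_increasing2)
next
  case False
  have "2 * (a * b) \<le> a\<^sup>2 + b\<^sup>2" using sum_squares_bound[of a b] by simp
  moreover have "a\<^sup>2 \<le> a powr p"
  proof (cases "a = 0")
    case True
    then show ?thesis by simp
  next
    case a: False
    with False assms have "a powr 2 \<le> a powr p" by (intro powr_mono') auto
    then show ?thesis using a assms by (simp add: powr_numeral)
  qed
  moreover have "0 \<le> a * b" using assms by simp
  moreover have "0 \<le> b\<^sup>2" by simp
  ultimately show ?thesis by linarith
qed

text \<open>For a fixed measurable index choice \<open>\<nu>\<close> and phase \<open>u\<close>, the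
  integral of \<open>u x * psum (\<nu> x) g x\<close> is linear in \<open>g\<close>, so the maximal
  inequality can be proved through an adjoint. The parameter \<open>m\<close> abbreviates the kernel
  bound.\<close>

locale linearized_partial_sum =
  fixes N :: nat and \<nu> :: "real ^ 'd \<Rightarrow> nat ^ 'd" and u :: "real ^ 'd \<Rightarrow> complex" and m :: real
  assumes m_def: "m = kernel_bound TYPE('d) N"
    and \<nu> [measurable]: "\<nu> \<in> measurable borel (count_space UNIV)"
    and \<nu>_cube: "\<And>x. \<nu> x \<in> cube_indices N"
    and u [measurable]: "u \<in> borel_measurable borel"
    and norm_u: "\<And>x. norm (u x) \<le> 1"
begin

lemma m_pos: "m > 0"
  by (simp add: m_def kernel_bound_pos)

abbreviation sel :: "int ^ 'd \<Rightarrow> real ^ 'd \<Rightarrow> complex" where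
  "sel k x \<equiv> of_bool (k \<in> rect_frequencies (\<nu> x))"

lemma sel_measurable [measurable]: "sel k \<in> borel_measurable borel"
  by (rule measurable_compose[OF \<nu>]) simp

text \<open>The weight of \<open>coef g k\<close> in the linearized integral of
  \<open>u x * psum (\<nu> x) g x\<close>.\<close>

definition c :: "int ^ 'd \<Rightarrow> complex" where
  "c k = (\<integral>x. u x * sel k x * torus_character k x \<partial>tor)"

text \<open>At \<open>top_index\<close> this is the polynomial P of the overview; other
  \<open>n\<close> give its truncations, of which the one at \<open>\<nu> x\<close> appears in the
  square estimate.\<close>

definition adj :: "nat ^ 'd \<Rightarrow> real ^ 'd \<Rightarrow> complex" where
  "adj n y = (\<Sum>k\<in>rect_frequencies n. c k * cnj (torus_character k y))"

lemma integrable_c: "integrable tor (\<lambda>x. u x * sel k x * torus_character k x)"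
  by (rule integrable_tor_bounded[of _ 1]) (auto simp: norm_mult norm_u of_bool_def)

lemma adj_measurable [measurable]: "adj n \<in> borel_measurable borel"
  unfolding adj_def by measurable

text \<open>The frequencies common to two centred rectangles form a rectangle again, indexed by the
  componentwise minimum. So a truncated adjoint integrates \<open>u\<close> against one Dirichlet
  kernel per point, and the common majorant applies whatever the index.\<close>

lemma norm_adj_le:
  assumes "n \<in> cube_indices N"
  shows "norm (adj n y) \<le> m"
proof -
  have "adj n y = (\<Sum>k\<in>rect_frequencies n. \<integral>x. u x * sel k x * torus_character k x * cnj (torus_character k y) \<partial>tor)"
    by (simp add: adj_def c_def)
  also have "\<dots> = (\<integral>x. (\<Sum>k\<in>rect_frequencies n. u x * sel k x * torus_character k x * cnj (torus_character k y)) \<partial>tor)"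
    by (rule Bochner_Integration.integral_sum[symmetric]) (intro integrable_mult_left integrable_c)
  also have "\<dots> = (\<integral>x. u x * dirichlet_kernel (\<chi> j. min (n $ j) (\<nu> x $ j)) (x - y) \<partial>tor)"
  proof (intro Bochner_Integration.integral_cong refl)
    fix x
    have "(\<Sum>k\<in>rect_frequencies n. u x * sel k x * torus_character k x * cnj (torus_character k y))
       = (\<Sum>k\<in>rect_frequencies n. if k \<in> rect_frequencies (\<nu> x) then u x * torus_character k (x - y) else 0)"
      by (intro sum.cong) (auto simp: torus_character_diff_point)
    also have "\<dots> = (\<Sum>k\<in>rect_frequencies n \<inter> rect_frequencies (\<nu> x). u x * torus_character k (x - y))"
      by (simp add: sum.inter_restrict finite_rect_frequencies)
    finally show "(\<Sum>k\<in>rect_frequencies n. u x * sel k x * torus_character k x * cnj (torus_character k y))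
        = u x * dirichlet_kernel (\<chi> j. min (n $ j) (\<nu> x $ j)) (x - y)"
      by (simp add: rect_frequencies_Int dirichlet_kernel_def sum_distrib_left)
  qed
  also have "norm \<dots> \<le> m"
    unfolding m_def
  proof (rule norm_integral_le_kernel_bound)
    fix x
    have "norm (u x * dirichlet_kernel (\<chi> j. min (n $ j) (\<nu> x $ j)) (x - y))
        \<le> 1 * norm (dirichlet_kernel (\<chi> j. min (n $ j) (\<nu> x $ j)) (x - y))"
      unfolding norm_mult by (intro mult_right_mono norm_u) auto
    also have "\<dots> \<le> (\<Prod>j\<in>UNIV. dirichlet_majorant N ((x - y) $ j))"
      unfolding mult_1 using \<nu>_cube[of x] by (intro norm_dirichlet_kernel_le) (auto simp: cube_indices_def min.coboundedI2)
    finally show "norm (u x * dirichlet_kernel (\<chi> j. min (n $ j) (\<nu> x $ j)) (x - y))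
       \<le> (\<Prod>j\<in>UNIV. dirichlet_majorant N ((x - y) $ j))" .
  qed
  finally show ?thesis .
qed

abbreviation top_index :: "nat ^ 'd" where "top_index \<equiv> (\<chi> j. N)"

lemma top_index_cube: "top_index \<in> cube_indices N"
  by (simp add: cube_indices_def)

text \<open>The Kolmogorov--Seliverstov step: since the index \<open>\<nu> x\<close> recurs in the expansion of \<open>\<Sum>\<bar>c k\<bar>\<^sup>2\<close>,
  this sum is again controlled by a single Dirichlet kernel instead of its square.\<close>

lemma integral_adj_square: "(\<integral>y. (norm (adj top_index y))\<^sup>2 \<partial>tor) \<le> m"
proof -
  let ?R = "rect_frequencies top_index :: (int ^ 'd) set"
  have "complex_of_real (\<integral>y. (norm (adj top_index y))\<^sup>2 \<partial>tor) = (\<integral>y. adj top_index y * cnj (adj top_index y) \<partial>tor)"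
    by (simp add: complex_norm_square flip: integral_complex_of_real of_real_power)
  also have "\<dots> = (\<integral>y. (\<Sum>k\<in>?R. \<Sum>l\<in>?R. c k * cnj (c l) * torus_character (l - k) y) \<partial>tor)"
    unfolding adj_def cnj_sum sum_product by (simp add: torus_character_diff mult_ac)
  also have "\<dots> = (\<Sum>k\<in>?R. \<Sum>l\<in>?R. c k * cnj (c l) * of_bool (l - k = 0))"
    by (subst Bochner_Integration.integral_sum, intro Bochner_Integration.integrable_sum integrable_mult_right integrable_torus_character)
       (subst Bochner_Integration.integral_sum, auto simp: integral_torus_character integrable_torus_character)
  also have "\<dots> = (\<Sum>k\<in>?R. c k * cnj (c k))"
    by (intro sum.cong refl) (simp add: of_bool_def if_distrib[of "(*) _"] finite_rect_frequencies cong: if_cong)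
  also have "\<dots> = (\<integral>x. (\<Sum>k\<in>?R. u x * sel k x * torus_character k x * cnj (c k)) \<partial>tor)"
    by (subst Bochner_Integration.integral_sum) (auto intro: integrable_mult_left integrable_c simp: c_def)
  also have "\<dots> = (\<integral>x. u x * cnj (adj (\<nu> x) x) \<partial>tor)"
  proof (intro Bochner_Integration.integral_cong refl)
    fix x
    have "(\<Sum>k\<in>?R. u x * sel k x * torus_character k x * cnj (c k)) = (\<Sum>k\<in>?R. if k \<in> rect_frequencies (\<nu> x) then u x * torus_character k x * cnj (c k) else 0)"
      by (intro sum.cong) auto
    also have "\<dots> = (\<Sum>k\<in>?R \<inter> rect_frequencies (\<nu> x). u x * torus_character k x * cnj (c k))"
      by (simp add: sum.inter_restrict finite_rect_frequencies)
    also have "?R \<inter> rect_frequencies (\<nu> x) = rect_frequencies (\<nu> x)"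
      using rect_frequencies_cube[OF \<nu>_cube[of x]] by blast
    finally show "(\<Sum>k\<in>?R. u x * sel k x * torus_character k x * cnj (c k)) = u x * cnj (adj (\<nu> x) x)"
      by (simp add: adj_def sum_distrib_left mult_ac)
  qed
  finally have eq: "complex_of_real (\<integral>y. (norm (adj top_index y))\<^sup>2 \<partial>tor) = (\<integral>x. u x * cnj (adj (\<nu> x) x) \<partial>tor)" .
  have "norm (complex_of_real (\<integral>y. (norm (adj top_index y))\<^sup>2 \<partial>tor)) \<le> (\<integral>x. norm (u x * cnj (adj (\<nu> x) x)) \<partial>tor)"
    unfolding eq by (rule integral_norm_bound)
  also have "\<dots> \<le> (\<integral>x. m \<partial>(tor :: (real ^ 'd) measure))"
  proof (rule integral_mono')
    fix x
    have "norm (u x) * norm (adj (\<nu> x) x) \<le> 1 * m"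
      by (intro mult_mono norm_u norm_adj_le \<nu>_cube) auto
    then show "norm (u x * cnj (adj (\<nu> x) x)) \<le> m" by (simp add: norm_mult)
  qed (use m_pos in auto)
  also have "\<dots> = m" by (simp add: tor.prob_space[unfolded space_tor])
  finally show ?thesis by simp
qed

text \<open>Duality: the indicator \<open>sel\<close> extends the sum to the fixed box of
  \<open>top_index\<close>, which moves the dependence on \<open>x\<close> into the coefficients and
  allows sum and integral to be exchanged.\<close>

lemma integral_linearized:
  assumes g: "integrable tor g"
  shows "(\<integral>x. u x * psum (\<nu> x) g x \<partial>tor) = (\<integral>y. g y * adj top_index y \<partial>tor)"
proof -
  let ?R = "rect_frequencies top_index :: (int ^ 'd) set"
  have "u x * psum (\<nu> x) g x = (\<Sum>k\<in>?R. u x * sel k x * torus_character k x * coef g k)" for x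
  proof -
    have "?R \<inter> rect_frequencies (\<nu> x) = rect_frequencies (\<nu> x)"
      using rect_frequencies_cube[OF \<nu>_cube[of x]] by blast
    then have "u x * psum (\<nu> x) g x = (\<Sum>k\<in>?R \<inter> rect_frequencies (\<nu> x). u x * (coef g k * torus_character k x))"
      by (simp add: psum_def sum_distrib_left)
    also have "\<dots> = (\<Sum>k\<in>?R. if k \<in> rect_frequencies (\<nu> x) then u x * (coef g k * torus_character k x) else 0)"
      by (simp add: sum.inter_restrict finite_rect_frequencies)
    also have "\<dots> = (\<Sum>k\<in>?R. u x * sel k x * torus_character k x * coef g k)"
      by (intro sum.cong) auto
    finally show ?thesis .
  qed
  then have "(\<integral>x. u x * psum (\<nu> x) g x \<partial>tor) = (\<integral>x. (\<Sum>k\<in>?R. u x * sel k x * torus_character k x * coef g k) \<partial>tor)"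
    by simp
  also have "\<dots> = (\<Sum>k\<in>?R. c k * coef g k)"
    by (subst Bochner_Integration.integral_sum) (auto intro: integrable_mult_left integrable_c simp: c_def)
  also have "\<dots> = (\<integral>y. (\<Sum>k\<in>?R. c k * (g y * torus_character (- k) y)) \<partial>tor)"
    by (subst Bochner_Integration.integral_sum) (auto intro!: integrable_mult_right integrable_mult_character g simp: coef_def)
  also have "\<dots> = (\<integral>y. g y * adj top_index y \<partial>tor)"
    by (simp add: adj_def sum_distrib_left torus_character_uminus mult_ac)
  finally show ?thesis .
qed

lemma linearized_bound:
  assumes g [measurable]: "g \<in> borel_measurable borel" and p: "1 \<le> p" "p \<le> 2" and B: "B > 0"
    and gp: "integrable tor (\<lambda>x. norm (g x) powr p)" "(\<integral>x. norm (g x) powr p \<partial>tor) \<le> B powr p"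
    and gi: "integrable tor g"
  shows "norm (\<integral>x. u x * psum (\<nu> x) g x \<partial>tor) \<le> 2 * m powr (1 / p) * B"
proof -
  \<comment> \<open>This scale balances the interpolation: \<open>B powr p / l powr p\<close> and
    \<open>m / m\<^sup>2\<close> both equal 1 / m, so the final sum is 2 l.\<close>
  define l where "l = B * m powr (1 / p)"
  have m: "m > 0" by (rule m_pos)
  have l: "l > 0" using B m by (simp add: l_def)
  have lp: "l powr p = B powr p * m"
    using B m p by (simp add: l_def powr_mult powr_powr)
  let ?P = "adj top_index"
  have Pint: "integrable tor (\<lambda>y. (norm (?P y))\<^sup>2)"
    by (rule integrable_tor_bounded[of _ "m\<^sup>2"]) (auto intro!: power_mono norm_adj_le top_index_cube)
  have pw: "norm (g y * ?P y) \<le> m * l * (norm (g y) powr p / l powr p + (norm (?P y))\<^sup>2 / m\<^sup>2)" for y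
  proof -
    have "(norm (g y) / l) * (norm (?P y) / m) \<le> (norm (g y) / l) powr p + (norm (?P y) / m)\<^sup>2"
      using l m p norm_adj_le[OF top_index_cube, of y] by (intro mult_le_powr_plus_square) auto
    then have "m * l * ((norm (g y) / l) * (norm (?P y) / m)) \<le> m * l * ((norm (g y) / l) powr p + (norm (?P y) / m)\<^sup>2)"
      using l m by (intro mult_left_mono) auto
    then show ?thesis using l m by (simp add: norm_mult powr_divide power_divide)
  qed
  have int: "integrable tor (\<lambda>y. m * l * (norm (g y) powr p / l powr p + (norm (?P y))\<^sup>2 / m\<^sup>2))"
    using gp(1) Pint by simp
  have "norm (\<integral>x. u x * psum (\<nu> x) g x \<partial>tor) \<le> (\<integral>y. norm (g y * ?P y) \<partial>tor)"
    unfolding integral_linearized[OF gi] by (rule integral_norm_bound)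
  also have "\<dots> \<le> (\<integral>y. m * l * (norm (g y) powr p / l powr p + (norm (?P y))\<^sup>2 / m\<^sup>2) \<partial>tor)"
    using l m by (intro integral_mono' int pw) simp
  also have "\<dots> = m * l * ((\<integral>y. norm (g y) powr p \<partial>tor) / l powr p + (\<integral>y. (norm (?P y))\<^sup>2 \<partial>tor) / m\<^sup>2)"
    using gp(1) Pint by simp
  also have "\<dots> \<le> m * l * (B powr p / l powr p + m / m\<^sup>2)"
    using l m by (intro mult_left_mono add_mono divide_right_mono gp(2) integral_adj_square) auto
  also have "\<dots> = 2 * l"
    using B m by (simp add: lp field_simps power2_eq_square)
  finally show ?thesis by (simp add: l_def mult_ac)
qed

end

section \<open>From the linearized bound to the maximal function\<close>

definition maximal_psum :: "nat \<Rightarrow> (real ^ 'd \<Rightarrow> complex) \<Rightarrow> real ^ 'd \<Rightarrow> real" where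
  "maximal_psum N g x = Max ((\<lambda>n. norm (psum n g x)) ` cube_indices N)"

lemma borel_measurable_psum [measurable]: "psum n g \<in> borel_measurable borel"
  unfolding psum_def by measurable

lemma norm_psum_le_maximal: "n \<in> cube_indices N \<Longrightarrow> norm (psum n g x) \<le> maximal_psum N g x"
  unfolding maximal_psum_def by (intro Max_ge) auto

lemma integrable_of_powr:
  assumes [measurable]: "g \<in> borel_measurable borel" and "1 \<le> p" "integrable tor (\<lambda>x. norm (g x) powr p)"
  shows "integrable tor (g :: real ^ 'd \<Rightarrow> complex)"
proof (rule Bochner_Integration.integrable_bound)
  show "integrable tor (\<lambda>x. 1 + norm (g x) powr p)" using assms by simp
  show "AE x in tor. norm (g x) \<le> norm (1 + norm (g x) powr p)"
  proof (intro AE_I2)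
    fix x
    show "norm (g x) \<le> norm (1 + norm (g x) powr p)"
    proof (cases "norm (g x) \<ge> 1")
      case True
      then have "norm (g x) powr 1 \<le> norm (g x) powr p" using assms by (intro powr_mono) auto
      then show ?thesis using True by simp
    qed (simp add: add_increasing2)
  qed
qed measurable

lemma maximal_psum_bound:
  fixes g :: "real ^ 'd \<Rightarrow> complex"
  assumes g [measurable]: "g \<in> borel_measurable borel" and p: "1 \<le> p" "p \<le> 2" and B: "B > 0"
    and gp: "integrable tor (\<lambda>x. norm (g x) powr p)" "(\<integral>x. norm (g x) powr p \<partial>tor) \<le> B powr p"
  shows "maximal_psum N g \<in> borel_measurable borel"
    and "(\<integral>\<^sup>+x. ennreal (maximal_psum N g x) \<partial>tor) \<le> ennreal (2 * kernel_bound TYPE('d) N powr (1 / p) * B)"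
proof -
  have "(cube_indices N :: (nat ^ 'd) set) \<noteq> {}" using cube_indices_nonempty by blast
  then obtain \<nu> :: "real ^ 'd \<Rightarrow> nat ^ 'd" where \<nu> [measurable]: "\<nu> \<in> measurable borel (count_space UNIV)"
    and \<nu>_cube: "\<And>x. \<nu> x \<in> cube_indices N"
    and \<nu>_max: "\<And>x n. n \<in> cube_indices N \<Longrightarrow> norm (psum n g x) \<le> norm (psum (\<nu> x) g x)"
    using measurable_argmax_selector[of "cube_indices N :: (nat ^ 'd) set" "\<lambda>n x. norm (psum n g x)" borel]
    by auto
  have eq: "maximal_psum N g x = norm (psum (\<nu> x) g x)" for x
    unfolding maximal_psum_def by (intro Max_eqI) (auto intro: \<nu>_max \<nu>_cube)
  have [measurable]: "(\<lambda>x. psum (\<nu> x) g x) \<in> borel_measurable borel"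
    by (rule measurable_compose_countable[of "\<lambda>n. psum n g", OF borel_measurable_psum \<nu>])
  show "maximal_psum N g \<in> borel_measurable borel"
    unfolding eq[abs_def] by measurable
  \<comment> \<open>The conjugate phase turns the integrand into its modulus. It is 0 where the
    partial sum vanishes, hence the locale condition of norm at most 1 instead of norm 1.\<close>
  define u where "u x = cnj (sgn (psum (\<nu> x) g x))" for x
  interpret linearized_partial_sum N \<nu> u "kernel_bound TYPE('d) N"
  proof
    show "u \<in> borel_measurable borel" unfolding u_def sgn_eq by measurable
  qed (auto simp: u_def norm_sgn intro: \<nu>_cube)
  have gi: "integrable tor g" by (rule integrable_of_powr[OF g p(1) gp(1)])
  \<comment> \<open>A crude finite bound, uniform in \<open>x\<close>, that secures
    integrability.\<close>
  define C where "C = (\<Sum>n\<in>(cube_indices N :: (nat ^ 'd) set). \<Sum>k\<in>rect_frequencies n. norm (coef g k))"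
  have "norm (psum (\<nu> x) g x) \<le> C" for x
  proof -
    have "norm (psum (\<nu> x) g x) \<le> (\<Sum>k\<in>rect_frequencies (\<nu> x). norm (coef g k))"
      unfolding psum_def by (rule order_trans[OF norm_sum]) (simp add: norm_mult)
    also have "\<dots> \<le> C"
      unfolding C_def by (rule member_le_sum[of "\<nu> x"]) (auto intro: sum_nonneg \<nu>_cube)
    finally show ?thesis .
  qed
  then have int: "integrable tor (\<lambda>x. norm (psum (\<nu> x) g x))"
    by (intro integrable_tor_bounded[of _ C]) auto
  have "u x * psum (\<nu> x) g x = complex_of_real (norm (psum (\<nu> x) g x))" for x
    by (cases "psum (\<nu> x) g x = 0") (simp_all add: u_def sgn_eq complex_norm_square[symmetric] power2_eq_square mult.commute)
  then have "(\<integral>x. norm (psum (\<nu> x) g x) \<partial>tor) = norm (\<integral>x. u x * psum (\<nu> x) g x \<partial>tor)"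
    by simp
  also have "\<dots> \<le> 2 * kernel_bound TYPE('d) N powr (1 / p) * B"
    by (rule linearized_bound[OF g p B gp gi])
  finally show "(\<integral>\<^sup>+x. ennreal (maximal_psum N g x) \<partial>tor) \<le> ennreal (2 * kernel_bound TYPE('d) N powr (1 / p) * B)"
    unfolding eq using int by (subst nn_integral_eq_integral) (auto intro: ennreal_leI)
qed

section \<open>Fejer means\<close>

definition fejer_box :: "nat \<Rightarrow> (int ^ 'd) set" where
  "fejer_box D = {m. \<forall>j. m $ j \<in> {0..<int D}}"

text \<open>The tensor-product Fejer kernel as a squared modulus: nonnegativity is immediate, and
  its Fourier coefficients are normalized counts of pairs in the box.\<close>

definition fejer :: "nat \<Rightarrow> real ^ 'd \<Rightarrow> real" where
  "fejer D h = (norm (\<Sum>m\<in>fejer_box D. torus_character m h))\<^sup>2 / real (D ^ CARD('d))"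

text \<open>Given directly as a trigonometric polynomial in the coefficients of \<open>g\<close>, so
  that its partial sums can be read off; the convolution form is
  \<open>fejer_mean_eq_integral\<close>.\<close>

definition fejer_mean :: "nat \<Rightarrow> (real ^ 'd \<Rightarrow> complex) \<Rightarrow> real ^ 'd \<Rightarrow> complex" where
  "fejer_mean D g x = (\<Sum>m\<in>fejer_box D. \<Sum>l\<in>fejer_box D.
      coef g (l - m) * torus_character (l - m) x) / of_nat (D ^ CARD('d))"

lemma finite_fejer_box [simp]: "finite (fejer_box D)"
  unfolding fejer_box_def by (rule finite_box) simp

lemma card_fejer_box: "card (fejer_box D :: (int ^ 'd) set) = D ^ CARD('d)"
  unfolding fejer_box_def by (subst card_box) auto

lemma fejer_nonneg: "0 \<le> fejer D h"
  by (simp add: fejer_def)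

lemma fejer_eq_sum:
  "complex_of_real (fejer D h) = (\<Sum>m\<in>fejer_box D. \<Sum>l\<in>fejer_box D. torus_character (m - l) h) / of_nat (D ^ CARD('d))"
  for h :: "real ^ 'd"
proof -
  let ?s = "\<Sum>m\<in>fejer_box D. torus_character m h"
  have "complex_of_real ((norm ?s)\<^sup>2) = ?s * cnj ?s"
    by (rule complex_norm_square)
  also have "\<dots> = (\<Sum>m\<in>fejer_box D. \<Sum>l\<in>fejer_box D. torus_character (m - l) h)"
    unfolding cnj_sum sum_product torus_character_diff ..
  finally show ?thesis by (simp add: fejer_def)
qed

lemma borel_measurable_fejer [measurable]: "fejer D \<in> borel_measurable borel"
  unfolding fejer_def by measurable

lemma fejer_le: "fejer D (h :: real ^ 'd) \<le> real (D ^ CARD('d))"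
proof -
  have "norm (\<Sum>m\<in>fejer_box D. torus_character m h) \<le> real (D ^ CARD('d))"
    by (rule order_trans[OF norm_sum]) (simp add: card_fejer_box)
  then have "(norm (\<Sum>m\<in>fejer_box D. torus_character m h))\<^sup>2 \<le> (real (D ^ CARD('d)))\<^sup>2"
    by (intro power_mono) auto
  then show ?thesis
    unfolding fejer_def by (cases "D = 0") (simp_all add: power_0_left pos_divide_le_eq power2_eq_square)
qed

lemma integrable_mult_fejer:
  fixes X :: "real ^ 'd \<Rightarrow> 'b::{real_normed_field, banach, second_countable_topology}"
  assumes "integrable tor X"
  shows "integrable tor (\<lambda>h. X h * of_real (fejer D h))"
proof (rule Bochner_Integration.integrable_bound)
  show "integrable tor (\<lambda>h. real (D ^ CARD('d)) *\<^sub>R X h)" using assms by simp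
  have [measurable]: "X \<in> borel_measurable borel" using borel_measurable_integrable[OF assms] by simp
  show "(\<lambda>h. X h * of_real (fejer D h)) \<in> borel_measurable tor" by measurable
  show "AE h in tor. norm (X h * of_real (fejer D h)) \<le> norm (real (D ^ CARD('d)) *\<^sub>R X h)"
  proof (intro AE_I2)
    fix h
    have "norm (X h) * fejer D h \<le> norm (X h) * real (D ^ CARD('d))"
      by (intro mult_left_mono fejer_le) auto
    then show "norm (X h * of_real (fejer D h)) \<le> norm (real (D ^ CARD('d)) *\<^sub>R X h)"
      using fejer_nonneg[of D h] by (simp add: norm_mult mult.commute)
  qed
qed

lemma integral_mult_fejer:
  fixes X :: "real ^ 'd \<Rightarrow> complex"
  assumes X: "integrable tor X"
  shows "(\<integral>h. X h * of_real (fejer D h) \<partial>tor)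
    = (\<Sum>m\<in>fejer_box D. \<Sum>l\<in>fejer_box D. \<integral>h. X h * torus_character (m - l) h \<partial>tor) / of_nat (D ^ CARD('d))"
proof -
  have "(\<integral>h. X h * of_real (fejer D h) \<partial>tor)
     = (\<integral>h. (\<Sum>m\<in>fejer_box D. \<Sum>l\<in>fejer_box D. X h * torus_character (m - l) h) / of_nat (D ^ CARD('d)) \<partial>tor)"
    by (simp add: fejer_eq_sum sum_distrib_left)
  also have "\<dots> = (\<integral>h. (\<Sum>m\<in>fejer_box D. \<Sum>l\<in>fejer_box D. X h * torus_character (m - l) h) \<partial>tor) / of_nat (D ^ CARD('d))"
    by (rule integral_divide_zero)
  also have "(\<integral>h. (\<Sum>m\<in>fejer_box D. \<Sum>l\<in>fejer_box D. X h * torus_character (m - l) h) \<partial>tor)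
    = (\<Sum>m\<in>fejer_box D. \<Sum>l\<in>fejer_box D. \<integral>h. X h * torus_character (m - l) h \<partial>tor)"
    by (subst Bochner_Integration.integral_sum, intro Bochner_Integration.integrable_sum integrable_mult_character X)
       (subst Bochner_Integration.integral_sum, auto intro: integrable_mult_character X)
  finally show ?thesis .
qed

text \<open>Orthogonality keeps only the pairs with l = m + k, leaving the number of box points that
  stay in the box when shifted by \<open>k\<close>.\<close>

lemma integral_fejer_character:
  "(\<integral>h. torus_character k h * of_real (fejer D h) \<partial>(tor :: (real ^ 'd) measure))
    = of_nat (card {m \<in> fejer_box D. m + k \<in> fejer_box D}) / of_nat (D ^ CARD('d))"
proof -
  have "(\<Sum>m\<in>fejer_box D. \<Sum>l\<in>fejer_box D. \<integral>h. torus_character k h * torus_character (m - l) h \<partial>tor)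
     = (\<Sum>m\<in>(fejer_box D :: (int ^ 'd) set). \<Sum>l\<in>fejer_box D. of_bool (m + k = l) :: complex)"
    unfolding torus_character_add[symmetric] integral_torus_character
    by (intro sum.cong refl arg_cong[where f = of_bool]) (auto simp: algebra_simps)
  also have "\<dots> = (\<Sum>m\<in>(fejer_box D :: (int ^ 'd) set). of_bool (m + k \<in> fejer_box D))"
    by (intro sum.cong refl) (simp add: of_bool_def)
  also have "\<dots> = of_nat (card {m \<in> fejer_box D. m + k \<in> fejer_box D})"
    by (simp add: of_bool_def sum.If_cases Int_def)
  finally show ?thesis
    by (subst integral_mult_fejer) (auto intro: integrable_torus_character)
qed

lemma integrable_fejer: "integrable tor (fejer D)"
  by (rule integrable_tor_bounded[of _ "real (D ^ CARD('a))"]) (auto simp: fejer_nonneg fejer_le simp del: of_nat_power)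

lemma integral_fejer:
  assumes "D > 0"
  shows "(\<integral>h. fejer D h \<partial>(tor :: (real ^ 'd) measure)) = 1"
proof -
  have "complex_of_real (\<integral>h. fejer D h \<partial>(tor :: (real ^ 'd) measure)) = 1"
    using integral_fejer_character[of "0 :: int ^ 'd" D] assms by (simp add: card_fejer_box)
  then show ?thesis by simp
qed

text \<open>A unit shift in coordinate \<open>j\<close> keeps (D - 1) D^(d-1) of the D^d box points,
  so the kernel integrates the cosine to 1 - 1/D, and the half-angle formula finishes. This exact
  moment measures the mass away from 0 without pointwise kernel estimates.\<close>

lemma integral_fejer_sin_square:
  assumes D: "D > 0"
  shows "(\<integral>h. (sin (h $ j / 2))\<^sup>2 * fejer D h \<partial>(tor :: (real ^ 'd) measure)) = 1 / (2 * real D)"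
proof -
  define e :: "int ^ 'd" where "e = axis j 1"
  have chi: "torus_character e h = cis (h $ j)" for h
    by (simp add: torus_character_def e_def axis_def cis_conv_exp if_distrib[of of_int] if_distrib[of "\<lambda>x. x * _"] cong: if_cong)
  have "m $ i \<in> {0..<int D} \<and> (m + e) $ i \<in> {0..<int D} \<longleftrightarrow> m $ i \<in> (if i = j then {0..<int D - 1} else {0..<int D})"
    for m i by (auto simp: e_def axis_def)
  then have "{m \<in> fejer_box D. m + e \<in> fejer_box D} = {m. \<forall>i. m $ i \<in> (if i = j then {0..<int D - 1} else {0..<int D})}"
    unfolding fejer_box_def mem_Collect_eq all_conj_distrib[symmetric] by simp
  then have "card {m \<in> fejer_box D. m + e \<in> fejer_box D} = (\<Prod>i\<in>(UNIV :: 'd set). card (if i = j then {0..<int D - 1} else {0..<int D}))"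
    by (simp only:) (rule card_box, simp)
  also have "\<dots> = card {0..<int D - 1} * (\<Prod>i\<in>UNIV - {j}. card (if i = j then {0..<int D - 1} else {0..<int D}))"
    by (subst prod.remove[of _ j]) auto
  also have "(\<Prod>i\<in>UNIV - {j}. card (if i = j then {0..<int D - 1} else {0..<int D})) = (\<Prod>i\<in>UNIV - {j}. D)"
    by (intro prod.cong) auto
  also have "card {0..<int D - 1} * (\<Prod>i\<in>UNIV - {j}. D) = (D - 1) * D ^ (CARD('d) - 1)"
    using D by (simp add: nat_diff_distrib)
  finally have card: "card {m \<in> fejer_box D. m + e \<in> fejer_box D} = (D - 1) * D ^ (CARD('d) - 1)" .
  have pow: "D ^ CARD('d) = D * D ^ (CARD('d) - 1)"
    using power_minus_mult[of "CARD('d)" D] by (simp add: mult.commute)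
  have "complex_of_real (Re (\<integral>h. torus_character e h * of_real (fejer D h) \<partial>(tor :: (real ^ 'd) measure))) = of_real (real (D - 1) / real D)"
    unfolding integral_fejer_character card pow of_nat_mult using D by simp
  also have "Re (\<integral>h. torus_character e h * of_real (fejer D h) \<partial>(tor :: (real ^ 'd) measure)) = (\<integral>h. cos (h $ j) * fejer D h \<partial>(tor :: (real ^ 'd) measure))"
    by (subst integral_Re[symmetric]) (auto simp: chi intro: integrable_mult_fejer[of "torus_character e", unfolded chi[abs_def]] integrable_torus_character[of e, unfolded chi[abs_def]])
  finally have cos: "(\<integral>h. cos (h $ j) * fejer D h \<partial>(tor :: (real ^ 'd) measure)) = real (D - 1) / real D"
    by (simp only: of_real_eq_iff)
  have ic: "integrable tor (\<lambda>h :: real ^ 'd. cos (h $ j) * fejer D h)"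
    using integrable_mult_fejer[of "\<lambda>h :: real ^ 'd. cos (h $ j)" D] by (simp add: integrable_tor_bounded[of _ 1])
  have "(sin (h $ j / 2))\<^sup>2 = (1 - cos (h $ j)) / 2" for h :: "real ^ 'd"
    using cos_double_sin[of "h $ j / 2"] by simp
  then have "(\<integral>h. (sin (h $ j / 2))\<^sup>2 * fejer D h \<partial>(tor :: (real ^ 'd) measure))
     = (\<integral>h. (fejer D h - cos (h $ j) * fejer D h) / 2 \<partial>tor)"
    by (simp only:) (simp only: times_divide_eq_left left_diff_distrib mult_1)
  also have "\<dots> = (1 - real (D - 1) / real D) / 2"
    using D by (simp add: integral_fejer integrable_fejer ic cos)
  also have "\<dots> = 1 / (2 * real D)"
    using D by (simp add: field_simps of_nat_diff)
  finally show ?thesis .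
qed

text \<open>The kernel is a sum of characters, so the identity is checked term by term: translating
  by \<open>x\<close> splits off a character at \<open>x\<close> and leaves a Fourier
  coefficient.\<close>

lemma fejer_mean_eq_integral:
  fixes g :: "real ^ 'd \<Rightarrow> complex"
  assumes [measurable]: "g \<in> borel_measurable borel" and per: "torus_periodic g" and gi: "integrable tor g"
  shows "(\<integral>h. g (x + h) * of_real (fejer D h) \<partial>tor) = fejer_mean D g x"
proof -
  have i: "integrable tor (\<lambda>h. g (x + h))"
    using integrable_tor_translate[of g x] per gi by (simp add: add.commute)
  have "(\<integral>h. g (x + h) * torus_character (m - l) h \<partial>tor) = coef g (l - m) * torus_character (l - m) x" for m l
  proof -
    have "(\<integral>h. g (x + h) * torus_character (m - l) h \<partial>tor)
       = (\<integral>h. torus_character (l - m) x * (g (h + x) * torus_character (- (l - m)) (h + x)) \<partial>tor)"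
    proof (intro Bochner_Integration.integral_cong refl)
      fix h
      have "torus_character (l - m) x * torus_character (- (l - m)) (h + x) = torus_character (m - l) h"
        using torus_character_mult_cnj[of "l - m" x] torus_character_uminus[of "l - m"]
        by (simp add: torus_character_add_point mult_ac)
      then show "g (x + h) * torus_character (m - l) h = torus_character (l - m) x * (g (h + x) * torus_character (- (l - m)) (h + x))"
        by (simp add: add.commute mult.left_commute)
    qed
    also have "\<dots> = torus_character (l - m) x * (\<integral>h. g (h + x) * torus_character (- (l - m)) (h + x) \<partial>tor)"
      by (rule integral_mult_right_zero)
    also have "(\<integral>h. g (h + x) * torus_character (- (l - m)) (h + x) \<partial>tor) = coef g (l - m)"
      unfolding coef_def using torus_periodic_character[of "- (l - m)"] per
      by (intro integral_tor_translate[of "\<lambda>h. g h * torus_character (- (l - m)) h"]) (auto simp: torus_periodic_def)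
    finally show ?thesis by (simp add: mult.commute)
  qed
  then show ?thesis
    unfolding fejer_mean_def by (subst integral_mult_fejer[OF i]) simp
qed

section \<open>Jensen's inequality and the approximation error of Fejer means in L^p\<close>

lemma powr_above_tangent:
  fixes t c p :: real
  assumes "0 \<le> t" "0 < c" "1 \<le> p"
  shows "c powr p + p * c powr (p - 1) * (t - c) \<le> t powr p"
\<comment> \<open>At 0 the claim is checked by hand, because the tangent inequality is taken on the
  open half-line.\<close>
proof (cases "t = 0")
  case True
  have "c powr (p - 1) * c = c powr p" using assms by (simp add: powr_diff)
  then have "c powr p + p * c powr (p - 1) * (t - c) = (1 - p) * c powr p"
    using True by (simp add: algebra_simps)
  also have "\<dots> \<le> 0" using assms by (intro mult_nonpos_nonneg) auto
  finally show ?thesis using True by simp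
next
  case False
  have "p * c powr (p - 1) * (t - c) \<le> t powr p - c powr p"
    using assms False
    by (intro convex_on_imp_above_tangent[of "{0<..}" "\<lambda>x. x powr p"] powr_convex)
       (auto intro!: derivative_eq_intros simp: interior_open powr_diff)
  then show ?thesis by simp
qed

text \<open>Jensen's inequality for the probability density \<open>w\<close>, by integrating the
  tangent line of t^p at the mean. The right side is a possibly infinite integral, the form suited
  to Fubini for nonnegative functions.\<close>

lemma powr_integral_le_nn_integral:
  fixes X w :: "'a \<Rightarrow> real"
  assumes [measurable]: "X \<in> borel_measurable M" and w: "integrable M w" "(\<integral>x. w x \<partial>M) = 1" "\<And>x. w x \<ge> 0"
    and X: "\<And>x. X x \<ge> 0" and Xw: "integrable M (\<lambda>x. X x * w x)" and p: "1 \<le> p"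
  shows "ennreal ((\<integral>x. X x * w x \<partial>M) powr p) \<le> (\<integral>\<^sup>+x. ennreal (X x powr p * w x) \<partial>M)"
proof -
  have [measurable]: "w \<in> borel_measurable M" using w(1) by (rule borel_measurable_integrable)
  define c where "c = (\<integral>x. X x * w x \<partial>M)"
  have c0: "c \<ge> 0" unfolding c_def by (intro Bochner_Integration.integral_nonneg) (simp add: X w)
  show ?thesis
  \<comment> \<open>For c = 0 the left side is 0, and for an infinite right side the claim is
    trivial; otherwise the tangent at \<open>c\<close> exists and the right side is a real
    integral.\<close>
  proof (cases "c = 0 \<or> (\<integral>\<^sup>+x. ennreal (X x powr p * w x) \<partial>M) = \<infinity>")
    case True
    then show ?thesis using c_def by auto
  next
    case False
    then have c: "c > 0" and fin: "(\<integral>\<^sup>+x. ennreal (X x powr p * w x) \<partial>M) < \<infinity>" using c0 by (auto simp: less_top)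
    have int: "integrable M (\<lambda>x. X x powr p * w x)"
      using fin by (intro integrableI_nonneg) (auto simp: w)
    have "c powr p = (\<integral>x. (c powr p - p * c powr (p - 1) * c) * w x + p * c powr (p - 1) * (X x * w x) \<partial>M)"
      using w Xw by (simp add: c_def[symmetric])
    also have "\<dots> \<le> (\<integral>x. X x powr p * w x \<partial>M)"
    proof (intro integral_mono int)
      show "integrable M (\<lambda>x. (c powr p - p * c powr (p - 1) * c) * w x + p * c powr (p - 1) * (X x * w x))"
        using w Xw by simp
      fix x
      have "(c powr p + p * c powr (p - 1) * (X x - c)) * w x \<le> X x powr p * w x"
        using powr_above_tangent[OF X c p] w by (intro mult_right_mono) auto
      then show "(c powr p - p * c powr (p - 1) * c) * w x + p * c powr (p - 1) * (X x * w x) \<le> X x powr p * w x"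
        by (simp add: algebra_simps)
    qed
    finally show ?thesis
      using int by (subst nn_integral_eq_integral) (auto simp: c_def[symmetric] w intro: ennreal_leI)
  qed
qed

text \<open>The kernel has integral one, so up to sign the error is the average of
  \<open>g (x + h) - g x\<close>, to which Jensen's inequality applies.\<close>

lemma norm_fejer_mean_diff_powr_le:
  fixes g :: "real ^ 'd \<Rightarrow> complex"
  assumes g [measurable]: "g \<in> borel_measurable borel" and per: "torus_periodic g" and gi: "integrable tor g"
    and D: "D > 0" and p: "1 \<le> p"
  shows "ennreal (norm (g x - fejer_mean D g x) powr p)
     \<le> (\<integral>\<^sup>+h. ennreal (norm (g (x + h) - g x) powr p * fejer D h) \<partial>tor)"
proof -
  have i: "integrable tor (\<lambda>h. g (x + h))"
    using integrable_tor_translate[of g x] per gi by (simp add: add.commute)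
  have i2: "integrable tor (\<lambda>h. g (x + h) - g x)" using i by simp
  have "g x - fejer_mean D g x = - (\<integral>h. (g (x + h) - g x) * of_real (fejer D h) \<partial>tor)"
    using D integrable_mult_fejer[OF i, of D] integrable_fejer[of D, where 'a = 'd]
    by (simp add: fejer_mean_eq_integral[OF g per gi, symmetric] left_diff_distrib integral_fejer)
  then have "norm (g x - fejer_mean D g x) \<le> (\<integral>h. norm ((g (x + h) - g x) * of_real (fejer D h)) \<partial>tor)"
    by simp
  also have "\<dots> = (\<integral>h. norm (g (x + h) - g x) * fejer D h \<partial>tor)"
    by (simp add: norm_mult fejer_nonneg)
  finally have "norm (g x - fejer_mean D g x) powr p \<le> (\<integral>h. norm (g (x + h) - g x) * fejer D h \<partial>tor) powr p"
    using p by (intro powr_mono2) auto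
  then have "ennreal (norm (g x - fejer_mean D g x) powr p) \<le> ennreal ((\<integral>h. norm (g (x + h) - g x) * fejer D h \<partial>tor) powr p)"
    by (rule ennreal_leI)
  also have "\<dots> \<le> (\<integral>\<^sup>+h. ennreal (norm (g (x + h) - g x) powr p * fejer D h) \<partial>tor)"
    using integrable_mult_fejer[of "\<lambda>h. norm (g (x + h) - g x)" D] i2 D
    by (intro powr_integral_le_nn_integral p) (auto simp: integral_fejer integrable_fejer fejer_nonneg)
  finally show ?thesis .
qed

text \<open>Twice the larger norm bounds the difference; 2^p is at most 4 for all admissible
  p.\<close>

lemma norm_diff_powr_le:
  fixes a b :: "'a::real_normed_vector"
  assumes "1 \<le> p" "p \<le> 2"
  shows "norm (a - b) powr p \<le> 4 * (norm a powr p + norm b powr p)"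
proof -
  define M where "M = max (norm a) (norm b)"
  have "norm (a - b) \<le> norm a + norm b" by (rule norm_triangle_ineq4)
  also have "\<dots> \<le> 2 * M" by (simp add: M_def)
  finally have "norm (a - b) powr p \<le> (2 * M) powr p" using assms by (intro powr_mono2) auto
  also have "\<dots> = 2 powr p * M powr p" by (simp add: powr_mult M_def)
  also have "\<dots> \<le> 2 powr 2 * (norm a powr p + norm b powr p)"
    using assms by (intro mult_mono powr_mono) (auto simp: M_def max_def)
  finally show ?thesis by (simp add: powr_numeral)
qed

text \<open>The crude bound for large shifts; translation invariance makes both terms equal, whence
  4 + 4 = 8.\<close>

lemma nn_integral_translate_diff_powr_le:
  fixes g :: "real ^ 'd \<Rightarrow> complex"
  assumes g [measurable]: "g \<in> borel_measurable borel" and per: "torus_periodic g"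
    and p: "1 \<le> p" "p \<le> 2" and gp: "integrable tor (\<lambda>x. norm (g x) powr p)"
  shows "(\<integral>\<^sup>+x. ennreal (norm (g (x + h) - g x) powr p) \<partial>tor) \<le> ennreal (8 * (\<integral>x. norm (g x) powr p \<partial>tor))"
proof -
  have "torus_periodic (\<lambda>x. ennreal (norm (g x) powr p))" using per by (simp add: torus_periodic_def)
  note tr = nn_integral_tor_translate[OF _ this, of h]
  have "(\<integral>\<^sup>+x. ennreal (norm (g (x + h) - g x) powr p) \<partial>tor)
    \<le> (\<integral>\<^sup>+x. ennreal 4 * ennreal (norm (g (x + h)) powr p) + ennreal 4 * ennreal (norm (g x) powr p) \<partial>tor)"
  proof (intro nn_integral_mono)
    fix x
    show "ennreal (norm (g (x + h) - g x) powr p) \<le> ennreal 4 * ennreal (norm (g (x + h)) powr p) + ennreal 4 * ennreal (norm (g x) powr p)"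
      using norm_diff_powr_le[OF p, of "g (x + h)" "g x"]
      by (simp add: ennreal_plus[symmetric] ennreal_mult[symmetric] del: ennreal_plus ennreal_numeral)
  qed
  also have "\<dots> = ennreal 4 * (\<integral>\<^sup>+x. ennreal (norm (g (x + h)) powr p) \<partial>tor) + ennreal 4 * (\<integral>\<^sup>+x. ennreal (norm (g x) powr p) \<partial>tor)"
    by (subst nn_integral_add) (auto simp: nn_integral_cmult)
  also have "\<dots> = ennreal 8 * (\<integral>\<^sup>+x. ennreal (norm (g x) powr p) \<partial>tor)"
    by (subst tr) (auto simp: distrib_right[symmetric])
  also have "\<dots> = ennreal (8 * (\<integral>x. norm (g x) powr p \<partial>tor))"
    using gp by (subst nn_integral_eq_integral) (auto simp: ennreal_mult')
  finally show ?thesis .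
qed

text \<open>A Chebyshev-type majorant for the indicator of large shifts: some coordinate is farther
  than \<delta> from the lattice, and \<open>circle_abs_le_sin\<close> turns this into a lower bound
  for its sine.\<close>

lemma one_le_sin_square_sum:
  assumes "torus_norm h > \<delta>" "\<delta> > 0"
  shows "1 \<le> pi\<^sup>2 / \<delta>\<^sup>2 * (\<Sum>j\<in>UNIV. (sin (h $ j / 2))\<^sup>2)"
proof -
  have "torus_norm h \<in> range (\<lambda>j. circle_abs (h $ j))"
    unfolding torus_norm_def by (rule Max_in) auto
  then obtain j where j: "torus_norm h = circle_abs (h $ j)" by auto
  have "\<delta>\<^sup>2 \<le> (pi * \<bar>sin (h $ j / 2)\<bar>)\<^sup>2"
    using assms circle_abs_le_sin[of "h $ j"] j by (intro power_mono) auto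
  also have "\<dots> = pi\<^sup>2 * (sin (h $ j / 2))\<^sup>2" by (simp add: power_mult_distrib)
  also have "\<dots> \<le> pi\<^sup>2 * (\<Sum>j\<in>UNIV. (sin (h $ j / 2))\<^sup>2)"
    by (intro mult_left_mono member_le_sum) auto
  finally show ?thesis using assms by (simp add: field_simps)
qed

text \<open>After Jensen and Fubini, shifts up to \<delta> are charged \<open>W\<close> and larger
  ones the crude bound times the sine sum. The exact moment 1 / (2 D) per coordinate turns the 8
  into the constant 4.\<close>

lemma fejer_mean_approximation:
  fixes g :: "real ^ 'd \<Rightarrow> complex"
  assumes g [measurable]: "g \<in> borel_measurable borel" and per: "torus_periodic g"
    and p: "1 \<le> p" "p \<le> 2" and gp: "integrable tor (\<lambda>x. norm (g x) powr p)"
    and D: "D > 0" and \<delta>: "\<delta> > 0"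
    and W: "\<And>h. torus_norm h \<le> \<delta> \<Longrightarrow> (\<integral>\<^sup>+x. ennreal (norm (g (x + h) - g x) powr p) \<partial>tor) \<le> ennreal W" "W \<ge> 0"
  shows "(\<integral>\<^sup>+x. ennreal (norm (g x - fejer_mean D g x) powr p) \<partial>tor)
     \<le> ennreal (W + 4 * real CARD('d) * pi\<^sup>2 * (\<integral>x. norm (g x) powr p \<partial>tor) / (real D * \<delta>\<^sup>2))"
proof -
  have gi: "integrable tor g" by (rule integrable_of_powr[OF g p(1) gp])
  define G where "G = (\<integral>x. norm (g x) powr p \<partial>tor)"
  have G: "G \<ge> 0" by (simp add: G_def)
  define s where "s h = (\<Sum>j\<in>UNIV. (sin (h $ j / 2))\<^sup>2)" for h :: "real ^ 'd"
  have s0: "s h \<ge> 0" for h by (simp add: s_def sum_nonneg)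
  \<comment> \<open>Both summands are nonnegative, so this one bound holds for all shifts and the
    integral over \<open>h\<close> is never split.\<close>
  have \<Phi>: "(\<integral>\<^sup>+x. ennreal (norm (g (x + h) - g x) powr p) \<partial>tor) \<le> ennreal (W + 8 * G * (pi\<^sup>2 / \<delta>\<^sup>2 * s h))" for h
  proof (cases "torus_norm h \<le> \<delta>")
    case True
    have "W \<le> W + 8 * G * (pi\<^sup>2 / \<delta>\<^sup>2 * s h)" using G s0 by simp
    then show ?thesis by (intro order_trans[OF W(1)[OF True]] ennreal_leI)
  next
    case False
    have "8 * G * 1 \<le> 8 * G * (pi\<^sup>2 / \<delta>\<^sup>2 * s h)"
      using False \<delta> G unfolding s_def by (intro mult_left_mono one_le_sin_square_sum) auto
    then have "8 * G \<le> W + 8 * G * (pi\<^sup>2 / \<delta>\<^sup>2 * s h)" using W(2) by simp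
    then show ?thesis
      using nn_integral_translate_diff_powr_le[OF g per p gp, of h, folded G_def] by (auto elim!: order_trans intro: ennreal_leI)
  qed
  have psf: "pair_sigma_finite (tor :: (real ^ 'd) measure) (tor :: (real ^ 'd) measure)"
    by (simp add: pair_sigma_finite_def tor.sigma_finite_measure_axioms)
  have ss: "integrable tor (\<lambda>h :: real ^ 'd. (sin (h $ j / 2))\<^sup>2 * fejer D h)" for j
    using integrable_mult_fejer[of "\<lambda>h :: real ^ 'd. (sin (h $ j / 2))\<^sup>2" D]
    by (simp add: integrable_tor_bounded[of _ 1] abs_square_le_1)
  have si: "integrable tor (\<lambda>h. s h * fejer D h)" "(\<integral>h. s h * fejer D h \<partial>tor) = real CARD('d) / (2 * real D)"
    unfolding s_def sum_distrib_right using D ss by (auto simp: integral_fejer_sin_square)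
  have "(\<integral>\<^sup>+x. ennreal (norm (g x - fejer_mean D g x) powr p) \<partial>tor)
     \<le> (\<integral>\<^sup>+x. (\<integral>\<^sup>+h. ennreal (norm (g (x + h) - g x) powr p * fejer D h) \<partial>tor) \<partial>tor)"
    by (intro nn_integral_mono norm_fejer_mean_diff_powr_le g per gi D p)
  also have "\<dots> = (\<integral>\<^sup>+h. (\<integral>\<^sup>+x. ennreal (norm (g (x + h) - g x) powr p * fejer D h) \<partial>tor) \<partial>tor)"
    by (rule pair_sigma_finite.Fubini'[OF psf, symmetric]) measurable
  also have "\<dots> = (\<integral>\<^sup>+h. (\<integral>\<^sup>+x. ennreal (norm (g (x + h) - g x) powr p) \<partial>tor) * ennreal (fejer D h) \<partial>tor)"
    by (intro nn_integral_cong) (simp add: ennreal_mult fejer_nonneg nn_integral_multc)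
  also have "\<dots> \<le> (\<integral>\<^sup>+h. ennreal (W + 8 * G * (pi\<^sup>2 / \<delta>\<^sup>2 * s h)) * ennreal (fejer D h) \<partial>tor)"
    by (intro nn_integral_mono mult_right_mono \<Phi>) simp
  also have "\<dots> = (\<integral>\<^sup>+h. ennreal (W * fejer D h + 8 * G * (pi\<^sup>2 / \<delta>\<^sup>2) * (s h * fejer D h)) \<partial>tor)"
    using W(2) G s0 by (intro nn_integral_cong) (simp add: ennreal_mult[symmetric] fejer_nonneg algebra_simps)
  also have "\<dots> = ennreal (\<integral>h. W * fejer D h + 8 * G * (pi\<^sup>2 / \<delta>\<^sup>2) * (s h * fejer D h) \<partial>tor)"
    using W(2) G s0 si by (intro nn_integral_eq_integral) (auto intro!: integrable_fejer fejer_nonneg AE_I2 add_nonneg_nonneg mult_nonneg_nonneg divide_nonneg_nonneg)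
  also have "(\<integral>h. W * fejer D h + 8 * G * (pi\<^sup>2 / \<delta>\<^sup>2) * (s h * fejer D h) \<partial>tor)
      = W + 8 * G * (pi\<^sup>2 / \<delta>\<^sup>2) * (real CARD('d) / (2 * real D))"
    using si D by (simp add: integrable_fejer integral_fejer)
  also have "\<dots> = W + 4 * real CARD('d) * pi\<^sup>2 * G / (real D * \<delta>\<^sup>2)"
    by simp
  finally show ?thesis unfolding G_def .
qed

section \<open>Convergence for Borel functions\<close>

lemma coef_diff:
  assumes "integrable tor f" "integrable tor g"
  shows "coef (\<lambda>x. f x - g x) k = coef f k - coef g k"
  unfolding coef_def left_diff_distrib
  by (intro Bochner_Integration.integral_diff integrable_mult_character assms)

lemma psum_diff:
  assumes "integrable tor f" "integrable tor g"
  shows "psum n (\<lambda>x. f x - g x) x = psum n f x - psum n g x"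
  by (simp add: psum_def coef_diff[OF assms] left_diff_distrib sum_subtractf)

lemma norm_coef_le:
  assumes "integrable tor f"
  shows "norm (coef f k) \<le> (\<integral>x. norm (f x) \<partial>tor)"
proof -
  have "norm (coef f k) \<le> (\<integral>x. norm (f x * torus_character (- k) x) \<partial>tor)"
    unfolding coef_def by (rule integral_norm_bound)
  then show ?thesis by (simp add: norm_mult)
qed

text \<open>The frequencies \<open>\<kappa> i\<close> may repeat, as differences of box points do in
  a Fejer mean; hence a sum over all indices with frequency \<open>k\<close>.\<close>

lemma coef_trig_sum:
  assumes "finite I"
  shows "coef (\<lambda>x. \<Sum>i\<in>I. a i * torus_character (\<kappa> i) x) k = (\<Sum>i\<in>I. if \<kappa> i = k then a i else 0)"
proof -
  have "coef (\<lambda>x. \<Sum>i\<in>I. a i * torus_character (\<kappa> i) x) k = (\<integral>x. (\<Sum>i\<in>I. a i * torus_character (\<kappa> i - k) x) \<partial>tor)"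
    by (simp add: coef_def sum_distrib_right torus_character_diff torus_character_uminus mult.assoc)
  also have "\<dots> = (\<Sum>i\<in>I. a i * of_bool (\<kappa> i - k = 0))"
    by (subst Bochner_Integration.integral_sum) (auto simp: integral_torus_character integrable_torus_character)
  also have "\<dots> = (\<Sum>i\<in>I. if \<kappa> i = k then a i else 0)"
    by (intro sum.cong) auto
  finally show ?thesis .
qed

lemma psum_trig_sum:
  assumes "finite I" "\<And>i. i \<in> I \<Longrightarrow> \<kappa> i \<in> rect_frequencies n"
  shows "psum n (\<lambda>x. \<Sum>i\<in>I. a i * torus_character (\<kappa> i) x) x = (\<Sum>i\<in>I. a i * torus_character (\<kappa> i) x)"
proof -
  have "psum n (\<lambda>x. \<Sum>i\<in>I. a i * torus_character (\<kappa> i) x) x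
    = (\<Sum>k\<in>rect_frequencies n. \<Sum>i\<in>I. if \<kappa> i = k then a i * torus_character k x else 0)"
    unfolding psum_def coef_trig_sum[OF assms(1)] sum_distrib_right by (intro sum.cong) auto
  also have "\<dots> = (\<Sum>i\<in>I. \<Sum>k\<in>rect_frequencies n. if \<kappa> i = k then a i * torus_character k x else 0)"
    by (rule sum.swap)
  also have "\<dots> = (\<Sum>i\<in>I. a i * torus_character (\<kappa> i) x)"
    using assms by (intro sum.cong refl) (simp add: finite_rect_frequencies)
  finally show ?thesis .
qed

lemma fejer_mean_trig_sum:
  "fejer_mean D g = (\<lambda>x. \<Sum>i\<in>fejer_box D \<times> fejer_box D.
      (coef g (snd i - fst i) / of_nat (D ^ CARD('d))) * torus_character (snd i - fst i) x)"
  for g :: "real ^ 'd \<Rightarrow> complex"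
  by (simp add: fejer_mean_def fun_eq_iff sum.cartesian_product case_prod_unfold sum_divide_distrib)

lemma fejer_box_diff: "i \<in> fejer_box D \<times> fejer_box D \<Longrightarrow> snd i - fst i \<in> rect_frequencies (\<chi> j. D)"
  unfolding fejer_box_def rect_frequencies_def mem_Times_iff mem_Collect_eq
proof (intro allI, elim conjE)
  fix j assume "\<forall>j. fst i $ j \<in> {0..<int D}" "\<forall>j. snd i $ j \<in> {0..<int D}"
  then have "fst i $ j \<in> {0..<int D}" "snd i $ j \<in> {0..<int D}" by auto
  then show "\<bar>(snd i - fst i) $ j\<bar> \<le> int ((\<chi> j. D) $ j)" by (simp add: abs_le_iff)
qed

lemma coef_fejer_mean_eq_0: "k \<notin> rect_frequencies (\<chi> j. D) \<Longrightarrow> coef (fejer_mean D g) k = 0"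
  unfolding fejer_mean_trig_sum
  by (subst coef_trig_sum, simp, intro sum.neutral ballI) (metis fejer_box_diff)

lemma psum_fejer_mean:
  assumes "\<And>j. D \<le> n $ j"
  shows "psum n (fejer_mean D g) x = fejer_mean D g x"
proof -
  have "rect_frequencies (\<chi> j. D) \<subseteq> rect_frequencies n"
    using assms unfolding rect_frequencies_def by (auto intro: order_trans)
  then show ?thesis
    unfolding fejer_mean_trig_sum using fejer_box_diff by (intro psum_trig_sum) (auto simp del: mem_Times_iff)
qed

text \<open>The mean has degree at most \<open>D\<close> in each coordinate, so a cutoff at N >= D
  removes no frequency of it. This brings arbitrary \<open>n\<close> into the cube over which the
  maximal function is taken.\<close>

lemma psum_fejer_mean_min:
  assumes "D \<le> N"
  shows "psum (\<chi> j. min (n $ j) N) (fejer_mean D g) x = psum n (fejer_mean D g) x"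
  unfolding psum_def
proof (rule sum.mono_neutral_left)
  show "rect_frequencies (\<chi> j. min (n $ j) N) \<subseteq> rect_frequencies n"
    unfolding rect_frequencies_def by (auto simp: of_nat_min)
  show "\<forall>k\<in>rect_frequencies n - rect_frequencies (\<chi> j. min (n $ j) N). coef (fejer_mean D g) k * torus_character k x = 0"
  proof
    fix k assume k: "k \<in> rect_frequencies n - rect_frequencies (\<chi> j. min (n $ j) N)"
    have "k \<notin> rect_frequencies (\<chi> j. D)"
    proof
      assume "k \<in> rect_frequencies (\<chi> j. D)"
      then have "k \<in> rect_frequencies (\<chi> j. N)"
        using assms unfolding rect_frequencies_def by (auto intro: order_trans)
      then have "k \<in> rect_frequencies (\<chi> j. min (n $ j) ((\<chi> j. N) $ j))"
        using k by (simp only: rect_frequencies_Int[symmetric]) blast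
      then show False using k by simp
    qed
    then show "coef (fejer_mean D g) k * torus_character k x = 0" by (simp add: coef_fejer_mean_eq_0)
  qed
qed (rule finite_rect_frequencies)

lemma borel_measurable_fejer_mean [measurable]: "fejer_mean D g \<in> borel_measurable borel"
  unfolding fejer_mean_trig_sum by measurable

lemma integrable_fejer_mean: "integrable tor (fejer_mean D g)"
  unfolding fejer_mean_trig_sum by (intro Bochner_Integration.integrable_sum integrable_mult_right integrable_torus_character)

section \<open>From summable maximal functions to almost everywhere convergence\<close>

lemma AE_summable_of_nn_integral:
  fixes F :: "nat \<Rightarrow> 'a \<Rightarrow> real"
  assumes [measurable]: "\<And>k. F k \<in> borel_measurable M" and F: "\<And>k x. 0 \<le> F k x"
    and a: "\<And>k. (\<integral>\<^sup>+x. ennreal (F k x) \<partial>M) \<le> ennreal (a k)" "\<And>k. 0 \<le> a k" "summable a"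
  shows "AE x in M. summable (\<lambda>k. F k x)"
proof -
  have "(\<integral>\<^sup>+x. (\<Sum>k. ennreal (F k x)) \<partial>M) = (\<Sum>k. \<integral>\<^sup>+x. ennreal (F k x) \<partial>M)"
    by (rule nn_integral_suminf) measurable
  also have "\<dots> \<le> (\<Sum>k. ennreal (a k))"
    by (intro suminf_le a) auto
  also have "\<dots> = ennreal (\<Sum>k. a k)"
    by (rule suminf_ennreal2[OF a(2,3)])
  finally have "(\<integral>\<^sup>+x. (\<Sum>k. ennreal (F k x)) \<partial>M) \<noteq> \<infinity>"
    by (auto simp: top_unique)
  then have "AE x in M. (\<Sum>k. ennreal (F k x)) \<noteq> \<infinity>"
    by (intro nn_integral_PInf_AE) auto
  then show ?thesis
    by eventually_elim (auto intro: summable_suminf_not_top F)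
qed

lemma maximal_psum_nonneg: "0 \<le> maximal_psum N g x"
  by (rule order_trans[OF norm_ge_zero norm_psum_le_maximal[OF cube_indices_nonempty]])

text \<open>The deterministic half, at one fixed \<open>x\<close>. Consecutive Fejer means differ by
  a difference of errors of \<open>g\<close>, so their partial sums differ by at most
  \<open>F k\<close>, uniformly in \<open>n\<close>. Telescoping and a limit bound the distance from
  \<open>psum n g x\<close> to \<open>psum n (W K) x\<close> by a tail of the series.\<close>

lemma psum_convergence_pointwise:
  fixes g :: "real ^ 'd \<Rightarrow> complex" and D :: "nat \<Rightarrow> nat"
  assumes gi: "integrable tor g" and D: "incseq D"
    and L1: "(\<lambda>k. \<integral>x. norm (g x - fejer_mean (D k) g x) \<partial>tor) \<longlonglongrightarrow> 0"
    and maximal: "summable (\<lambda>k. maximal_psum (D (Suc k)) (\<lambda>x. g x - fejer_mean (D k) g x) x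
        + maximal_psum (D (Suc k)) (\<lambda>x. g x - fejer_mean (D (Suc k)) g x) x)"
    and V: "(\<lambda>k. fejer_mean (D k) g x) \<longlonglongrightarrow> g x"
  shows "((\<lambda>n. psum n g x) \<longlongrightarrow> g x) pringsheim"
proof -
  define W where "W k = fejer_mean (D k) g" for k
  define F where "F k = maximal_psum (D (Suc k)) (\<lambda>x. g x - W k x) x
        + maximal_psum (D (Suc k)) (\<lambda>x. g x - W (Suc k) x) x" for k
  have Fs: "summable F" using maximal by (simp add: F_def[abs_def] W_def)
  have F0: "F k \<ge> 0" for k by (simp add: F_def maximal_psum_nonneg)
  have Wi: "integrable tor (W k)" for k unfolding W_def by (rule integrable_fejer_mean)
  have step: "norm (psum n (W (Suc k)) x - psum n (W k) x) \<le> F k" for n k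
  proof -
    \<comment> \<open>Both means have degree at most \<open>D (Suc k)\<close>, so truncating
      \<open>n\<close> there leaves their partial sums unchanged and makes the maximal function
      applicable.\<close>
    define n' :: "nat ^ 'd" where "n' = (\<chi> j. min (n $ j) (D (Suc k)))"
    have n': "n' \<in> cube_indices (D (Suc k))" by (simp add: n'_def cube_indices_def)
    have "psum n (W (Suc k)) x - psum n (W k) x = psum n' (W (Suc k)) x - psum n' (W k) x"
      unfolding n'_def W_def using D by (simp add: psum_fejer_mean_min incseqD)
    also have "\<dots> = psum n' (\<lambda>x. g x - W k x) x - psum n' (\<lambda>x. g x - W (Suc k) x) x"
      by (simp add: psum_diff gi Wi)
    also have "norm \<dots> \<le> norm (psum n' (\<lambda>x. g x - W k x) x) + norm (psum n' (\<lambda>x. g x - W (Suc k) x) x)"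
      by (rule norm_triangle_ineq4)
    also have "\<dots> \<le> F k"
      unfolding F_def by (intro add_mono norm_psum_le_maximal n')
    finally show ?thesis .
  qed
  have telescope: "norm (psum n (W (K + M)) x - psum n (W K) x) \<le> (\<Sum>i<M. F (K + i))" for n K M
  proof (induction M)
    case (Suc M)
    have "norm (psum n (W (K + Suc M)) x - psum n (W K) x)
        \<le> norm (psum n (W (Suc (K + M))) x - psum n (W (K + M)) x) + norm (psum n (W (K + M)) x - psum n (W K) x)"
      using norm_triangle_ineq[of "psum n (W (Suc (K + M))) x - psum n (W (K + M)) x" "psum n (W (K + M)) x - psum n (W K) x"] by simp
    also have "\<dots> \<le> F (K + M) + (\<Sum>i<M. F (K + i))" by (intro add_mono step Suc.IH)
    finally show ?case by simp
  qed simp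
  have coef_lim: "(\<lambda>k. coef (W k) l) \<longlonglongrightarrow> coef g l" for l
  proof -
    have "norm (coef g l - coef (W k) l) \<le> (\<integral>x. norm (g x - W k x) \<partial>tor)" for k
      using norm_coef_le[of "\<lambda>x. g x - W k x" l] gi Wi[of k] by (simp add: coef_diff)
    then have "(\<lambda>k. coef g l - coef (W k) l) \<longlonglongrightarrow> 0"
      by (intro Lim_null_comparison[OF always_eventually L1[folded W_def]] allI)
    from tendsto_diff[OF tendsto_const[of "coef g l"] this] show ?thesis by simp
  qed
  \<comment> \<open>For fixed \<open>n\<close> only finitely many coefficients occur, and each
    converges because the means converge in L^1.\<close>
  have psum_lim: "(\<lambda>k. psum n (W k) x) \<longlonglongrightarrow> psum n g x" for n
    unfolding psum_def by (intro tendsto_intros coef_lim)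
  have tail: "norm (psum n g x - psum n (W K) x) \<le> (\<Sum>i. F (K + i))" for n K
  proof (rule tendsto_upperbound)
    show "(\<lambda>M. norm (psum n (W (M + K)) x - psum n (W K) x)) \<longlonglongrightarrow> norm (psum n g x - psum n (W K) x)"
      by (intro tendsto_intros LIMSEQ_ignore_initial_segment psum_lim)
    have sF: "summable (\<lambda>i. F (K + i))" using summable_ignore_initial_segment[OF Fs, of K] by (simp add: add.commute)
    have "norm (psum n (W (M + K)) x - psum n (W K) x) \<le> (\<Sum>i. F (K + i))" for M
      using telescope[of n K M] sum_le_suminf[OF sF, of "{..<M}"] F0 by (simp add: add.commute)
    then show "\<forall>\<^sub>F M in sequentially. norm (psum n (W (M + K)) x - psum n (W K) x) \<le> (\<Sum>i. F (K + i))"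
      by simp
  qed simp
  show ?thesis
  proof (rule tendstoI)
    fix e :: real assume e: "e > 0"
    have "(\<lambda>K. \<Sum>i. F (i + K)) \<longlonglongrightarrow> 0" by (rule suminf_exist_split2[OF Fs])
    then have "\<forall>\<^sub>F K in sequentially. dist (\<Sum>i. F (i + K)) 0 < e / 2"
      using e by (intro tendstoD) auto
    moreover have "\<forall>\<^sub>F K in sequentially. dist (W K x) (g x) < e / 2"
      using V e unfolding W_def by (intro tendstoD) auto
    ultimately have "\<forall>\<^sub>F K in sequentially. dist (\<Sum>i. F (i + K)) 0 < e / 2 \<and> dist (W K x) (g x) < e / 2"
      by eventually_elim auto
    then obtain K where K: "dist (\<Sum>i. F (i + K)) 0 < e / 2" "dist (W K x) (g x) < e / 2"
      using eventually_happens'[OF sequentially_bot] by blast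
    have "\<forall>\<^sub>F n in pringsheim. D K \<le> Min (range (\<lambda>j. (n :: nat ^ 'd) $ j))"
      unfolding pringsheim_def by (rule eventually_filtercomapI) (rule eventually_ge_at_top)
    then show "\<forall>\<^sub>F n in pringsheim. dist (psum n g x) (g x) < e"
    proof eventually_elim
      case (elim n)
      \<comment> \<open>All components of \<open>n\<close> are at least \<open>D K\<close>, so
        \<open>W K\<close> is reproduced and only the tail and its error at \<open>x\<close>
        remain.\<close>
      then have "psum n (W K) x = W K x"
        unfolding W_def by (intro psum_fejer_mean) (auto intro: order_trans)
      then have "dist (psum n g x) (W K x) < e / 2"
        using tail[of n K] K(1) by (simp add: dist_norm add.commute)
      then show ?case using K(2) dist_triangle[of "psum n g x" "g x" "W K x"] by simp
    qed
  qed
qed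

text \<open>A scaled form of t <= 1 + t^p, taking the place of Hoelder's inequality in the passage
  from L^p to L^1.\<close>

lemma norm_le_add_powr:
  fixes B p t :: real
  assumes "B > 0" "1 \<le> p" "t \<ge> 0"
  shows "t \<le> B + B * (t powr p / B powr p)"
proof (cases "t \<le> B")
  case True
  then show ?thesis using assms by (simp add: add_increasing2)
next
  case False
  have "t / B = (t / B) powr 1" using assms False by simp
  also have "\<dots> \<le> (t / B) powr p" using assms False by (intro powr_mono) auto
  finally have "B * (t / B) \<le> B * (t powr p / B powr p)"
    using assms by (intro mult_left_mono) (auto simp: powr_divide)
  then show ?thesis using assms by simp
qed

lemma integral_norm_le_of_powr:
  fixes r :: "real ^ 'd \<Rightarrow> complex"
  assumes [measurable]: "r \<in> borel_measurable borel" and B: "B > 0" and p: "1 \<le> p"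
    and rp: "integrable tor (\<lambda>x. norm (r x) powr p)" "(\<integral>x. norm (r x) powr p \<partial>tor) \<le> B powr p"
  shows "(\<integral>x. norm (r x) \<partial>tor) \<le> 2 * B"
proof -
  have "(\<integral>x. norm (r x) \<partial>tor) \<le> (\<integral>x. B + B * (norm (r x) powr p / B powr p) \<partial>tor)"
    using rp B p by (intro integral_mono' norm_le_add_powr) auto
  also have "\<dots> = B + B * ((\<integral>x. norm (r x) powr p \<partial>tor) / B powr p)"
    using rp by (simp add: tor.prob_space[unfolded space_tor])
  also have "\<dots> \<le> B + B * (B powr p / B powr p)"
    using rp B by (intro add_mono mult_left_mono divide_right_mono) auto
  also have "\<dots> = 2 * B" using B by simp
  finally show ?thesis .
qed

text \<open>At stage \<open>k\<close> the errors of both means \<open>D k\<close> and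
  \<open>D (Suc k)\<close> are measured by the maximal function of level \<open>D (Suc k)\<close>;
  hence the pairing of that kernel bound with \<open>B k + B (Suc k)\<close>.\<close>

lemma psum_convergence_AE:
  fixes g :: "real ^ 'd \<Rightarrow> complex" and D :: "nat \<Rightarrow> nat" and B :: "nat \<Rightarrow> real"
  assumes g [measurable]: "g \<in> borel_measurable borel" and p: "1 \<le> p" "p \<le> 2"
    and gp: "integrable tor (\<lambda>x. norm (g x) powr p)" and D: "incseq D"
    and B: "\<And>k. B k > 0"
    and approx: "\<And>k. (\<integral>\<^sup>+x. ennreal (norm (g x - fejer_mean (D k) g x) powr p) \<partial>tor) \<le> ennreal (B k powr p)"
    and sB: "summable B" "summable (\<lambda>k. kernel_bound TYPE('d) (D (Suc k)) powr (1 / p) * (B k + B (Suc k)))"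
  shows "AE x in tor. ((\<lambda>n. psum n g x) \<longlongrightarrow> g x) pringsheim"
proof -
  define r where "r k x = g x - fejer_mean (D k) g x" for k x
  have [measurable]: "r k \<in> borel_measurable borel" for k unfolding r_def by measurable
  have gi: "integrable tor g" by (rule integrable_of_powr[OF g p(1) gp])
  have rp: "integrable tor (\<lambda>x. norm (r k x) powr p)" for k
    using approx[of k] by (intro integrableI_nonneg) (auto simp: r_def[symmetric] less_top[symmetric] top_unique)
  have rp2: "(\<integral>x. norm (r k x) powr p \<partial>tor) \<le> B k powr p" for k
    using approx[of k] nn_integral_eq_integral[OF rp[of k]] by (simp add: r_def[symmetric])
  have ri: "integrable tor (r k)" for k
    by (rule integrable_of_powr[OF _ p(1) rp]) measurable
  have L1: "(\<integral>x. norm (r k x) \<partial>tor) \<le> 2 * B k" for k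
    by (rule integral_norm_le_of_powr[OF _ B p(1) rp rp2]) measurable
  have mm [measurable]: "maximal_psum N (r k) \<in> borel_measurable borel" for N k
    by (rule maximal_psum_bound[OF _ p B rp rp2]) measurable
  let ?m = "\<lambda>k. kernel_bound TYPE('d) (D (Suc k)) powr (1 / p)"
  have m0: "?m k \<ge> 0" for k by simp
  have mb: "(\<integral>\<^sup>+x. ennreal (maximal_psum (D (Suc k)) (r i) x) \<partial>tor) \<le> ennreal (2 * ?m k * B i)" for k i
    by (rule maximal_psum_bound[OF _ p B rp rp2]) measurable
  have lim: "(\<lambda>k. \<integral>x. norm (r k x) \<partial>tor) \<longlonglongrightarrow> 0"
  proof (rule tendsto_sandwich[OF _ _ tendsto_const])
    show "(\<lambda>k. 2 * B k) \<longlonglongrightarrow> 0"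
      using tendsto_mult_right_zero[OF summable_LIMSEQ_zero[OF sB(1)], of 2] by simp
  qed (use L1 in auto)
  have "AE x in tor. summable (\<lambda>k. maximal_psum (D (Suc k)) (r k) x + maximal_psum (D (Suc k)) (r (Suc k)) x)"
  proof (rule AE_summable_of_nn_integral)
    show "(\<lambda>x. maximal_psum (D (Suc k)) (r k) x + maximal_psum (D (Suc k)) (r (Suc k)) x) \<in> borel_measurable tor" for k
      by measurable
    show "0 \<le> maximal_psum (D (Suc k)) (r k) x + maximal_psum (D (Suc k)) (r (Suc k)) x" for k x
      by (simp add: maximal_psum_nonneg)
    show "0 \<le> 2 * (?m k * (B k + B (Suc k)))" for k
      using B[of k] B[of "Suc k"] m0[of k] by simp
    show "summable (\<lambda>k. 2 * (?m k * (B k + B (Suc k))))"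
      by (intro summable_mult sB)
    fix k
    have "(\<integral>\<^sup>+x. ennreal (maximal_psum (D (Suc k)) (r k) x + maximal_psum (D (Suc k)) (r (Suc k)) x) \<partial>tor)
      = (\<integral>\<^sup>+x. ennreal (maximal_psum (D (Suc k)) (r k) x) + ennreal (maximal_psum (D (Suc k)) (r (Suc k)) x) \<partial>tor)"
      by (simp add: maximal_psum_nonneg)
    also have "\<dots> = (\<integral>\<^sup>+x. ennreal (maximal_psum (D (Suc k)) (r k) x) \<partial>tor) + (\<integral>\<^sup>+x. ennreal (maximal_psum (D (Suc k)) (r (Suc k)) x) \<partial>tor)"
      by (rule nn_integral_add) measurable
    also have "\<dots> \<le> ennreal (2 * ?m k * B k) + ennreal (2 * ?m k * B (Suc k))"
      by (intro add_mono mb)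
    also have "\<dots> = ennreal (2 * (?m k * (B k + B (Suc k))))"
      using B[of k] B[of "Suc k"] m0[of k] by (simp add: ennreal_plus[symmetric] algebra_simps del: ennreal_plus)
    finally show "(\<integral>\<^sup>+x. ennreal (maximal_psum (D (Suc k)) (r k) x + maximal_psum (D (Suc k)) (r (Suc k)) x) \<partial>tor)
        \<le> ennreal (2 * (?m k * (B k + B (Suc k))))" .
  qed
  \<comment> \<open>Summable L^1 errors also give almost everywhere convergence of the Fejer means
    themselves along \<open>D\<close>.\<close>
  moreover have "AE x in tor. summable (\<lambda>k. norm (r k x))"
  proof (rule AE_summable_of_nn_integral)
    show "(\<integral>\<^sup>+x. ennreal (norm (r k x)) \<partial>tor) \<le> ennreal (2 * B k)" for k
      using ri[of k] L1[of k] by (subst nn_integral_eq_integral) (auto intro: ennreal_leI)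
  qed (use B sB in \<open>auto intro: less_imp_le\<close>)
  ultimately show ?thesis
  proof eventually_elim
    case (elim x)
    have "(\<lambda>k. r k x) \<longlonglongrightarrow> 0"
      using summable_LIMSEQ_zero[OF elim(2)] by (rule tendsto_norm_zero_cancel)
    from tendsto_diff[OF tendsto_const[of "g x"] this] have "(\<lambda>k. fejer_mean (D k) g x) \<longlonglongrightarrow> g x"
      by (simp add: r_def)
    then show ?case
      using elim(1) lim unfolding r_def by (intro psum_convergence_pointwise[OF gi D]) auto
  qed
qed

section \<open>The theorem under a modulus condition\<close>

text \<open>Superadditivity, by which a sum of two p-th powers of errors is absorbed into the p-th
  power of a single \<open>B k\<close>.\<close>

lemma powr_add_le_powr:
  fixes a b p :: real
  assumes "0 \<le> a" "0 \<le> b" "1 \<le> p"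
  shows "a powr p + b powr p \<le> (a + b) powr p"
proof (cases "a = 0 \<or> b = 0")
  case True
  then show ?thesis using assms by auto
next
  case False
  then have ab: "a > 0" "b > 0" using assms by auto
  have "a powr p = a * a powr (p - 1)" "b powr p = b * b powr (p - 1)"
    using ab by (simp_all add: powr_mult_base)
  moreover have "a * a powr (p - 1) \<le> a * (a + b) powr (p - 1)" "b * b powr (p - 1) \<le> b * (a + b) powr (p - 1)"
    using ab assms by (auto intro!: mult_left_mono powr_mono2)
  moreover have "(a + b) powr p = (a + b) * (a + b) powr (p - 1)"
    using ab by (simp add: powr_mult_base)
  ultimately show ?thesis by (simp add: distrib_right)
qed

lemma kernel_bound_powr_le:
  fixes L p :: real
  assumes L: "L \<ge> 1" and D: "real D \<le> exp (4 * L) + 1" and p: "1 \<le> p"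
  shows "kernel_bound TYPE('d::finite) D powr (1 / p) \<le> (28 * L) powr (real CARD('d) / p)"
proof -
  have "1 \<le> exp (4 * L)" using L by simp
  \<comment> \<open>4 (exp (4 L) + 1) + 3 is at most 11 exp (4 L) as the exponential is at least 1;
    further down, ln 11 <= 10 <= 10 L gives 14 L.\<close>
  then have "4 * real D + 3 \<le> 11 * exp (4 * L)" using D by linarith
  then have "ln (4 * real D + 3) \<le> ln (11 * exp (4 * L))" by (intro ln_mono) auto
  also have "\<dots> = ln 11 + 4 * L" by (simp add: ln_mult)
  also have "\<dots> \<le> 14 * L" using ln_le_minus_one[of 11] L by simp
  finally have le: "2 * ln (4 * real D + 3) \<le> 28 * L" by simp
  have pos: "2 * ln (4 * real D + 3) > 0" by simp
  have "kernel_bound TYPE('d) D = (2 * ln (4 * real D + 3)) powr real CARD('d)"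
    unfolding kernel_bound_def using pos by (subst powr_realpow) auto
  then have "kernel_bound TYPE('d) D powr (1 / p) = (2 * ln (4 * real D + 3)) powr (real CARD('d) / p)"
    by (simp add: powr_powr)
  also have "\<dots> \<le> (28 * L) powr (real CARD('d) / p)"
    using le pos p by (intro powr_mono2) auto
  finally show ?thesis .
qed

lemma summable_exp_exp:
  "summable (\<lambda>k::nat. exp (real (Suc k)) powr a * exp (- exp (real (Suc k))))"
proof (rule summable_comparison_test_bigo)
  show "summable (\<lambda>k::nat. norm ((1 / 2 :: real) ^ k))" by simp
  show "(\<lambda>k::nat. exp (real (Suc k)) powr a * exp (- exp (real (Suc k)))) \<in> O(\<lambda>k. (1 / 2) ^ k)"
    by real_asymp
qed

text \<open>At scale exp(-L) with L = exp(k + 1), a degree of order exp(4 L) costs a factor of order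
  L^(d/p) in the maximal inequality. The negative power in the modulus cancels exactly this, leaving
  the summable values of \<psi>.\<close>

lemma psum_convergence_of_modulus:
  fixes g :: "real ^ 'd \<Rightarrow> complex"
  assumes g [measurable]: "g \<in> borel_measurable borel" and per: "torus_periodic g"
    and p: "1 \<le> p" "p \<le> 2" and gp: "integrable tor (\<lambda>x. norm (g x) powr p)"
    and \<psi>: "\<And>k. 0 \<le> \<psi> (real (Suc k))" "summable (\<lambda>k. \<psi> (real (Suc k)))" and A: "0 \<le> A"
    and modulus: "\<And>k h. torus_norm h \<le> exp (- exp (real (Suc k))) \<Longrightarrow>
       (\<integral>\<^sup>+x. ennreal (norm (g (x + h) - g x) powr p) \<partial>tor)
         \<le> ennreal ((A * exp (real (Suc k)) powr (- (real CARD('d) / p)) * \<psi> (real (Suc k))) powr p)"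
  shows "AE x in tor. ((\<lambda>n. psum n g x) \<longlongrightarrow> g x) pringsheim"
proof -
  define L where "L k = exp (real (Suc k))" for k
  define a where "a = real CARD('d) / p"
  \<comment> \<open>The factor 4 makes the degree times the squared scale at least exp (2 L), so
    large shifts contribute at most C exp (- 2 L).\<close>
  define D where "D k = nat \<lceil>exp (4 * L k)\<rceil>" for k
  define C where "C = 4 * real CARD('d) * pi\<^sup>2 * (\<integral>x. norm (g x) powr p \<partial>tor)"
  define w where "w k = A * L k powr (- a) * \<psi> (real (Suc k))" for k
  \<comment> \<open>Adding 1 to \<open>C\<close> makes \<open>T k\<close> positive and
    \<open>C\<close> at most \<open>(C + 1) powr p\<close>.\<close>
  define T where "T k = (C + 1) * exp (- L k)" for k
  define B where "B k = w k + T k" for k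
  \<comment> \<open>28 comes from \<open>kernel_bound_powr_le\<close>; exp 1 is the ratio of
    consecutive \<open>L k\<close>, since the kernel bound at stage \<open>k\<close> has level
    \<open>D (Suc k)\<close>.\<close>
  define K where "K = (28 * exp 1) powr a"
  have L1: "L k \<ge> 1" and LSuc: "L (Suc k) = exp 1 * L k" for k
    by (simp_all add: L_def exp_add[symmetric])
  have L0: "L k > 0" for k by (simp add: L_def)
  have a: "a \<ge> 0" using p by (simp add: a_def)
  have C0: "C \<ge> 0" by (simp add: C_def)
  have w0: "w k \<ge> 0" for k using A \<psi>(1)[of k] by (simp add: w_def)
  have T0: "T k > 0" for k using C0 by (simp add: T_def add_pos_nonneg add.commute)
  have B0: "B k > 0" for k using w0[of k] T0[of k] by (simp add: B_def)
  have Dge: "exp (4 * L k) \<le> real (D k)" for k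
    unfolding D_def by linarith
  have Dle: "real (D k) \<le> exp (4 * L k) + 1" for k
  proof -
    have "-1 < exp (4 * L k)" using exp_gt_zero[of "4 * L k"] by linarith
    then show ?thesis
      unfolding D_def using of_int_ceiling_le_add_one[of "exp (4 * L k)"] by (simp add: zero_le_ceiling)
  qed
  have Dpos: "D k > 0" for k using Dge[of k] exp_gt_zero[of "4 * L k"] by linarith
  have Dinc: "incseq D"
    unfolding D_def L_def by (intro incseq_SucI nat_mono ceiling_mono) simp
  have Wa: "L k powr a * w k = A * \<psi> (real (Suc k))" for k
  proof -
    have "L k powr a * L k powr (- a) = 1" using L0[of k] by (simp add: powr_add[symmetric])
    then show ?thesis by (simp add: w_def mult_ac)
  qed
  have La: "L k powr a \<ge> 1" for k using L1[of k] a by (rule ge_one_powr_ge_zero)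
  \<comment> \<open>The error times the maximal loss: in the modulus part the powers of
    \<open>L k\<close> cancel, and the remaining part decays doubly exponentially.\<close>
  define b where "b k = L k powr a * B k" for k
  have sb: "summable b"
  proof -
    have "b = (\<lambda>k. A * \<psi> (real (Suc k)) + (C + 1) * (L k powr a * exp (- L k)))"
      by (simp add: fun_eq_iff b_def B_def distrib_left Wa) (simp add: T_def mult_ac)
    then show ?thesis
      using summable_exp_exp[of a] \<psi>(2) unfolding L_def by (auto intro!: summable_add summable_mult)
  qed
  have Bb: "B k \<le> b k" for k
    using La[of k] B0[of k] mult_right_mono[of 1 "L k powr a" "B k"] by (simp add: b_def)
  show ?thesis
  proof (rule psum_convergence_AE[OF g p gp Dinc B0])
    show "summable B"
      by (rule summable_comparison_test'[OF sb, of 0]) (use Bb B0 in \<open>auto simp: less_imp_le\<close>)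
    show "summable (\<lambda>k. kernel_bound TYPE('d) (D (Suc k)) powr (1 / p) * (B k + B (Suc k)))"
    proof (rule summable_comparison_test'[of "\<lambda>k. K * (b k + b (Suc k))" 0])
      show "summable (\<lambda>k. K * (b k + b (Suc k)))"
        using sb by (intro summable_mult summable_add) (auto simp: summable_Suc_iff)
      fix k
      have "kernel_bound TYPE('d) (D (Suc k)) powr (1 / p) \<le> (28 * L (Suc k)) powr a"
        unfolding a_def by (rule kernel_bound_powr_le[OF L1 Dle p(1)])
      also have "\<dots> = K * L k powr a"
        using L0[of k] by (simp add: LSuc K_def powr_mult mult_ac)
      finally have "kernel_bound TYPE('d) (D (Suc k)) powr (1 / p) * (B k + B (Suc k)) \<le> K * L k powr a * (B k + B (Suc k))"
        using B0[of k] B0[of "Suc k"] by (intro mult_right_mono) auto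
      also have "\<dots> = K * (b k + L k powr a * B (Suc k))"
        by (simp add: b_def algebra_simps)
      also have "\<dots> \<le> K * (b k + b (Suc k))"
      proof -
        have "L k powr a \<le> L (Suc k) powr a"
          using a by (intro powr_mono2) (auto simp: L_def)
        then have "L k powr a * B (Suc k) \<le> b (Suc k)"
          unfolding b_def using B0[of "Suc k"] by (intro mult_right_mono) auto
        then show ?thesis by (intro mult_left_mono) (auto simp: K_def)
      qed
      finally show "norm (kernel_bound TYPE('d) (D (Suc k)) powr (1 / p) * (B k + B (Suc k))) \<le> K * (b k + b (Suc k))"
        using B0[of k] B0[of "Suc k"] by simp
    qed
    fix k
    have "(\<integral>\<^sup>+x. ennreal (norm (g x - fejer_mean (D k) g x) powr p) \<partial>tor)
       \<le> ennreal (w k powr p + C / (real (D k) * (exp (- L k))\<^sup>2))"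
      unfolding C_def
    proof (rule fejer_mean_approximation[OF g per p gp Dpos])
      show "(\<integral>\<^sup>+x. ennreal (norm (g (x + h) - g x) powr p) \<partial>tor) \<le> ennreal (w k powr p)"
        if "torus_norm h \<le> exp (- L k)" for h
        using modulus[of h k] that unfolding w_def L_def a_def by simp
    qed auto
    also have "\<dots> \<le> ennreal (B k powr p)"
    proof (rule ennreal_leI)
      have "exp (2 * L k) = exp (4 * L k) * (exp (- L k))\<^sup>2"
        by (simp add: exp_add[symmetric] power2_eq_square)
      also have "\<dots> \<le> real (D k) * (exp (- L k))\<^sup>2"
        by (intro mult_right_mono Dge) auto
      finally have "C / (real (D k) * (exp (- L k))\<^sup>2) \<le> C / exp (2 * L k)"
        using C0 Dpos[of k] by (intro divide_left_mono) auto
      also have "\<dots> = C * exp (- L k) powr 2"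
        by (simp add: exp_minus exp_double divide_inverse power_inverse)
      also have "\<dots> \<le> (C + 1) powr p * exp (- L k) powr p"
      proof (intro mult_mono)
        have "(C + 1) powr 1 \<le> (C + 1) powr p" using C0 p by (intro powr_mono) auto
        then show "C \<le> (C + 1) powr p" using C0 by simp
        \<comment> \<open>The base is at most 1, so lowering the exponent from 2 to p only increases
          the power.\<close>
        show "exp (- L k) powr 2 \<le> exp (- L k) powr p"
          using p L0[of k] by (intro powr_mono') auto
      qed auto
      also have "\<dots> = T k powr p"
        using C0 by (simp add: T_def powr_mult)
      finally have "w k powr p + C / (real (D k) * (exp (- L k))\<^sup>2) \<le> w k powr p + T k powr p" by simp
      also have "\<dots> \<le> B k powr p"
        unfolding B_def using w0[of k] T0[of k] p by (intro powr_add_le_powr) auto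
      finally show "w k powr p + C / (real (D k) * (exp (- L k))\<^sup>2) \<le> B k powr p" .
    qed
    finally show "(\<integral>\<^sup>+x. ennreal (norm (g x - fejer_mean (D k) g x) powr p) \<partial>tor) \<le> ennreal (B k powr p)" .
  qed
qed

section \<open>Passage between Lebesgue measure on the cell and the Borel measure
  \<open>tor\<close>\<close>

lemma sets_torus_measure: "S \<in> sets borel \<Longrightarrow> S \<inter> torus_cell \<in> sets torus_measure"
  by (auto simp: torus_measure_def sets_restrict_space)

lemma space_torus_measure: "space torus_measure = torus_cell"
  by (simp add: torus_measure_def space_scale_measure space_restrict_space)

lemma borel_measurable_torus_measure: "F \<in> borel_measurable borel \<Longrightarrow> F \<in> borel_measurable torus_measure"
  by (rule measurableI) (auto simp: space_torus_measure Int_commute[of torus_cell] vimage_def dest: measurable_sets intro!: sets_torus_measure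
      simp flip: vimage_def)

text \<open>\<open>tor\<close> is an image measure of \<open>torus_measure\<close> under the
  identity, so the transfer of integrals and null sets becomes a change of variables.\<close>

lemma distr_torus_measure: "distr torus_measure borel (\<lambda>x. x) = (tor :: (real ^ 'd) measure)"
proof (rule measure_eqI)
  fix S :: "(real ^ 'd) set" assume "S \<in> sets (distr torus_measure borel (\<lambda>x. x))"
  then have S [measurable]: "S \<in> sets borel" by simp
  let ?c = "ennreal (1 / (2 * pi) ^ CARD('d))"
  have "emeasure (distr torus_measure borel (\<lambda>x. x)) S = emeasure torus_measure (S \<inter> torus_cell)"
    by (subst emeasure_distr) (auto simp: space_torus_measure intro!: borel_measurable_torus_measure)
  also have "\<dots> = ?c * emeasure lborel (S \<inter> torus_cell)"
    by (simp add: torus_measure_def emeasure_restrict_space)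
  also have "\<dots> = ?c * (\<integral>\<^sup>+x. indicator torus_cell x * indicator S x \<partial>lborel)"
    by (simp add: indicator_inter_arith[symmetric] Int_commute)
  also have "\<dots> = emeasure tor S"
    by (subst nn_integral_tor[symmetric]) auto
  finally show "emeasure (distr torus_measure borel (\<lambda>x. x)) S = emeasure tor S" .
qed simp

lemma integral_torus_measure:
  fixes F :: "real ^ 'd \<Rightarrow> 'b::{banach, second_countable_topology}"
  assumes "F \<in> borel_measurable borel"
  shows "(\<integral>x. F x \<partial>torus_measure) = (\<integral>x. F x \<partial>tor)"
  unfolding distr_torus_measure[symmetric] using assms
  by (subst integral_distr) (auto intro!: borel_measurable_torus_measure)

lemma integrable_torus_measure:
  fixes F :: "real ^ 'd \<Rightarrow> 'b::{banach, second_countable_topology}"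
  assumes "F \<in> borel_measurable borel"
  shows "integrable torus_measure F \<longleftrightarrow> integrable tor F"
  unfolding distr_torus_measure[symmetric] using assms
  by (subst integrable_distr_eq) (auto intro!: borel_measurable_torus_measure)

lemma AE_torus_measure:
  assumes "AE x in tor. P x"
  shows "AE x in torus_measure. P x"
  using assms unfolding distr_torus_measure[symmetric]
  by (rule AE_distrD[rotated]) (auto intro!: borel_measurable_torus_measure)

lemma AE_tor_iff: "(AE x in tor. P x) \<longleftrightarrow> (AE x in lborel. x \<in> torus_cell \<longrightarrow> P x)"
  unfolding tor_def by (subst AE_density) (auto simp: indicator_def zero_less_mult_iff ennreal_zero_less_mult_iff cong: if_cong)

lemma borel_measurable_torus_measure_iff:
  fixes F :: "real ^ 'd \<Rightarrow> 'b::real_normed_vector"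
  shows "F \<in> borel_measurable torus_measure \<longleftrightarrow> (\<lambda>x. indicator torus_cell x *\<^sub>R F x) \<in> borel_measurable lebesgue"
  unfolding torus_measure_def
  by (subst borel_measurable_restrict_space_iff[symmetric]) (auto intro!: measurable_cong_sets)

text \<open>By completeness of Lebesgue measure: after extension by zero the two functions differ on
  a null set all of whose subsets are measurable, so a preimage under \<open>F\<close> is a Borel
  set changed by measurable null sets.\<close>

lemma borel_measurable_torus_measure_AE:
  fixes F G :: "real ^ 'd \<Rightarrow> complex"
  assumes [measurable]: "G \<in> borel_measurable borel" and eq: "AE x in tor. F x = G x"
  shows "F \<in> borel_measurable torus_measure"
  unfolding borel_measurable_torus_measure_iff
proof (rule measurableI)
  let ?F = "\<lambda>x. indicator torus_cell x *\<^sub>R F x" and ?G = "\<lambda>x. indicator torus_cell x *\<^sub>R G x"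
  fix S :: "complex set" assume S [measurable]: "S \<in> sets borel"
  have AE: "AE x in lborel. ?F x = ?G x"
    using eq[unfolded AE_tor_iff] by eventually_elim (auto simp: indicator_def)
  have "AE x in lborel. \<not> (?F x \<noteq> ?G x \<and> ?F x \<in> S)" "AE x in lborel. \<not> (?F x \<noteq> ?G x \<and> ?G x \<in> S)"
    using AE by (eventually_elim, simp)+
  from this[THEN sets_completion_AE]
  have *: "{x \<in> space lebesgue. ?F x \<noteq> ?G x \<and> ?F x \<in> S} \<in> sets lebesgue" "{x \<in> space lebesgue. ?F x \<noteq> ?G x \<and> ?G x \<in> S} \<in> sets lebesgue"
    by (auto simp: pred_def)
  have "{x \<in> space lborel. ?G x \<in> S} \<in> sets lborel" by measurable
  then have GS: "{x. ?G x \<in> S} \<in> sets lebesgue" by (simp add: sets_completionI_sets)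
  have F_eq: "?F -` S \<inter> space lebesgue = ({x. ?G x \<in> S} - {x \<in> space lebesgue. ?F x \<noteq> ?G x \<and> ?G x \<in> S})
     \<union> {x \<in> space lebesgue. ?F x \<noteq> ?G x \<and> ?F x \<in> S}"
    by auto
  show "?F -` S \<inter> space lebesgue \<in> sets lebesgue"
    unfolding F_eq by (intro sets.Un sets.Diff GS *)
qed simp

text \<open>A Borel function agreeing almost everywhere on the cell is made periodic by
  \<open>torus_reduce\<close>. Agreement is recorded for every translate because the modulus of
  continuity compares translates; it follows from invariance of null sets.\<close>

lemma torus_measurable_borel_representative:
  fixes f :: "real ^ 'd \<Rightarrow> complex"
  assumes "f \<in> borel_measurable torus_measure" and per: "torus_periodic f"
  obtains g where "g \<in> borel_measurable borel" "torus_periodic g" "\<And>h. AE x in tor. f (x + h) = g (x + h)"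
proof -
  let ?f = "\<lambda>x. indicator torus_cell x *\<^sub>R f x"
  have [measurable]: "?f \<in> borel_measurable lebesgue"
    using assms(1) by (simp add: borel_measurable_torus_measure_iff)
  have "(\<lambda>x. Re (?f x)) \<in> borel_measurable lebesgue" "(\<lambda>x. Im (?f x)) \<in> borel_measurable lebesgue"
    by measurable
  from this[THEN completion_ex_borel_measurable_real]
  obtain u v where uv [measurable]: "u \<in> borel_measurable borel" "v \<in> borel_measurable borel"
    and eq: "AE x in lborel. Re (?f x) = u x" "AE x in lborel. Im (?f x) = v x"
    by auto
  define g where "g x = Complex (u (torus_reduce x)) (v (torus_reduce x))" for x
  have "g = (\<lambda>x. complex_of_real (u (torus_reduce x)) + \<i> * complex_of_real (v (torus_reduce x)))"
    by (simp add: g_def fun_eq_iff complex_eq_iff)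
  then have gm: "g \<in> borel_measurable borel" by simp
  have gper: "torus_periodic g" unfolding g_def by (rule torus_periodic_comp_reduce)
  have "AE x in lborel. x \<in> torus_cell \<longrightarrow> f x = g x"
    using eq by eventually_elim (auto simp: g_def torus_reduce_id complex_eq_iff indicator_def)
  then have "AE x in tor. f x = g x" by (simp add: AE_tor_iff)
  then have "AE x in tor. f (torus_reduce x) = g (torus_reduce x)"
    by (simp add: torus_periodic_reduce per gper)
  then have "AE x in tor. f (torus_reduce (x + h)) = g (torus_reduce (x + h))" for h
    by (rule AE_tor_translate)
  then have "AE x in tor. f (x + h) = g (x + h)" for h
    by (simp add: torus_periodic_reduce per gper)
  then show thesis by (rule that[OF gm gper])
qed

lemma torus_Lp_norm_translate_diff:
  fixes f :: "real ^ 'd \<Rightarrow> complex"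
  assumes g [measurable]: "g \<in> borel_measurable borel" and fg: "\<And>h. AE x in tor. f (x + h) = g (x + h)"
  shows "torus_Lp_norm p (\<lambda>x. f (x + h) - f x) = (\<integral>x. norm (g (x + h) - g x) powr p \<partial>tor) powr (1 / p)"
proof -
  have AE: "AE x in tor. f (x + h) - f x = g (x + h) - g x"
    using fg[of h] fg[of 0] by eventually_elim simp
  have "(\<integral>x. norm (f (x + h) - f x) powr p \<partial>torus_measure) = (\<integral>x. norm (g (x + h) - g x) powr p \<partial>torus_measure)"
  proof (rule integral_cong_AE)
    \<comment> \<open>The congruence of integrals asks for measurability on both sides; for the
      translated \<open>f\<close> it comes from almost everywhere agreement with a Borel
      function.\<close>
    have "(\<lambda>x. f (x + h) - f x) \<in> borel_measurable torus_measure"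
      by (rule borel_measurable_torus_measure_AE[OF _ AE]) measurable
    then show "(\<lambda>x. norm (f (x + h) - f x) powr p) \<in> borel_measurable torus_measure" by measurable
    show "(\<lambda>x. norm (g (x + h) - g x) powr p) \<in> borel_measurable torus_measure"
      by (intro borel_measurable_torus_measure) measurable
    show "AE x in torus_measure. norm (f (x + h) - f x) powr p = norm (g (x + h) - g x) powr p"
      using AE_torus_measure[OF AE] by eventually_elim simp
  qed
  also have "\<dots> = (\<integral>x. norm (g (x + h) - g x) powr p \<partial>tor)"
    by (rule integral_torus_measure) measurable
  finally show ?thesis by (simp add: torus_Lp_norm_def)
qed

lemma nn_integral_translate_diff_le_modulus:
  fixes f :: "real ^ 'd \<Rightarrow> complex"
  assumes g [measurable]: "g \<in> borel_measurable borel" and per: "torus_periodic g"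
    and fg: "\<And>h. AE x in tor. f (x + h) = g (x + h)"
    and p: "1 \<le> p" "p \<le> 2" and gp: "integrable tor (\<lambda>x. norm (g x) powr p)"
    and h: "torus_norm h \<le> \<delta>" and M: "Lp_modulus p \<delta> f \<le> M"
  shows "(\<integral>\<^sup>+x. ennreal (norm (g (x + h) - g x) powr p) \<partial>tor) \<le> ennreal (M powr p)"
proof -
  let ?I = "\<lambda>h. \<integral>x. norm (g (x + h) - g x) powr p \<partial>tor"
  let ?G = "8 * (\<integral>x. norm (g x) powr p \<partial>tor)"
  have nn: "(\<integral>\<^sup>+x. ennreal (norm (g (x + h) - g x) powr p) \<partial>tor) \<le> ennreal ?G" for h
    by (rule nn_integral_translate_diff_powr_le[OF g per p gp])
  have i: "integrable tor (\<lambda>x. norm (g (x + h) - g x) powr p)" for h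
    using nn[of h] by (intro integrableI_nonneg) (auto simp: less_top[symmetric] top_unique)
  have I: "(\<integral>\<^sup>+x. ennreal (norm (g (x + h) - g x) powr p) \<partial>tor) = ennreal (?I h)" for h
    by (rule nn_integral_eq_integral[OF i]) simp
  have bdd: "?I h \<le> ?G" for h
    using nn[of h] by (simp add: I)
  have "?I h powr (1 / p) \<le> Lp_modulus p \<delta> f"
    unfolding Lp_modulus_def torus_Lp_norm_translate_diff[OF g fg]
  proof (rule cSUP_upper)
    \<comment> \<open>A real supremum bounds its members only over a bounded set; the crude estimate
      for arbitrary shifts supplies the bound.\<close>
    show "bdd_above ((\<lambda>h. ?I h powr (1 / p)) ` {h. torus_norm h \<le> \<delta>})"
      using p by (intro bdd_aboveI2[of _ _ "?G powr (1 / p)"] powr_mono2 bdd) auto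
  qed (use h in simp)
  also note M
  finally have "(?I h powr (1 / p)) powr p \<le> M powr p"
    using p by (intro powr_mono2) auto
  then have "?I h \<le> M powr p"
    using p by (simp add: powr_powr)
  then show ?thesis unfolding I by (rule ennreal_leI)
qed

theorem theorem1p2:
  fixes p :: real
    and \<psi> :: "real \<Rightarrow> real"
    and f :: "real ^ 'd \<Rightarrow> complex"
  assumes "CARD('d) \<ge> 2"
    and "1 \<le> p" and "p \<le> 2"
    and "\<And>t. t \<ge> 1 \<Longrightarrow> \<psi> t > 0"
    and "antimono_on {1..} \<psi>"
    and "summable (\<lambda>k. \<psi> (real (Suc k)))"
    and "f \<in> torus_Lp p"
    and "\<exists>A :: real. \<forall>\<delta>. 0 < \<delta> \<and> \<delta> \<le> 1/2 \<longrightarrow>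
           Lp_modulus p \<delta> f
             \<le> A * ln (1 / \<delta>) powr (- (real CARD('d) / p)) * \<psi> (ln (ln (exp (exp 1) / \<delta>)))"
  shows "AE x in torus_measure. ((\<lambda>n. rect_partial_sum n f x) \<longlongrightarrow> f x) pringsheim"
proof -
  note p = assms(2,3)
  have f: "torus_periodic f" "f \<in> borel_measurable torus_measure" "integrable torus_measure (\<lambda>x. norm (f x) powr p)"
    using assms(7) by (auto simp: torus_Lp_def)
  \<comment> \<open>Integrability, Fourier coefficients and the modulus are all carried over from
    \<open>f\<close> to this periodic Borel function.\<close>
  obtain g where g [measurable]: "g \<in> borel_measurable borel" and per: "torus_periodic g"
    and fg: "\<And>h. AE x in tor. f (x + h) = g (x + h)"
    using torus_measurable_borel_representative[OF f(2,1)] by metis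
  have fg0: "AE x in torus_measure. f x = g x"
    using AE_torus_measure[OF fg[of 0]] by simp
  have gt: "g \<in> borel_measurable torus_measure" by (rule borel_measurable_torus_measure[OF g])
  have "integrable torus_measure (\<lambda>x. norm (g x) powr p)"
  proof (rule integrable_cong_AE_imp[OF f(3)])
    show "(\<lambda>x. norm (g x) powr p) \<in> borel_measurable torus_measure" using gt by measurable
    show "AE x in torus_measure. norm (f x) powr p = norm (g x) powr p"
      using fg0 by eventually_elim simp
  qed
  then have gp: "integrable tor (\<lambda>x. norm (g x) powr p)"
    by (subst (asm) integrable_torus_measure) auto
  have coef: "fourier_coeff f k = coef g k" for k
  proof -
    have chi: "torus_character (- k) \<in> borel_measurable torus_measure"
      by (rule borel_measurable_torus_measure) measurable
    have "fourier_coeff f k = (\<integral>x. g x * torus_character (- k) x \<partial>torus_measure)"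
      unfolding fourier_coeff_def
    proof (rule integral_cong_AE)
      show "AE x in torus_measure. f x * torus_character (- k) x = g x * torus_character (- k) x"
        using fg0 by eventually_elim simp
    qed (use f(2) gt chi in measurable)
    also have "\<dots> = coef g k"
      unfolding coef_def by (rule integral_torus_measure) measurable
    finally show ?thesis .
  qed
  obtain A where A: "\<And>\<delta>. 0 < \<delta> \<Longrightarrow> \<delta> \<le> 1/2 \<Longrightarrow> Lp_modulus p \<delta> f
             \<le> A * ln (1 / \<delta>) powr (- (real CARD('d) / p)) * \<psi> (ln (ln (exp (exp 1) / \<delta>)))"
    using assms(8) by auto
  have "AE x in tor. ((\<lambda>n. psum n g x) \<longlongrightarrow> g x) pringsheim"
  proof (rule psum_convergence_of_modulus[OF g per p gp _ assms(6), of "\<bar>A\<bar>"])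
    show "0 \<le> \<psi> (real (Suc k))" for k using assms(4)[of "real (Suc k)"] by simp
    fix k and h :: "real ^ 'd"
    define L where "L = exp (real (Suc k))"
    assume "torus_norm h \<le> exp (- exp (real (Suc k)))"
    then have h: "torus_norm h \<le> exp (- L)" by (simp add: L_def)
    have L1: "1 \<le> L" by (simp add: L_def)
    \<comment> \<open>The hypothesis covers \<delta> up to 1/2; L >= 1 and exp 1 >= 2 place the
      scale exp (- L) in this range.\<close>
    have "exp (- L) \<le> exp (- 1)" using L1 by simp
    also have "\<dots> \<le> 1 / 2" using exp_ge_add_one_self[of 1] by (simp add: exp_minus field_simps)
    finally have "Lp_modulus p (exp (- L)) f
       \<le> A * ln (1 / exp (- L)) powr (- (real CARD('d) / p)) * \<psi> (ln (ln (exp (exp 1) / exp (- L))))"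
      by (intro A) auto
    also have "ln (1 / exp (- L)) = L" by (simp add: ln_div)
    also have "ln (exp (exp 1) / exp (- L)) = exp 1 + L" by (simp add: exp_diff[symmetric])
    \<comment> \<open>The sign of \<open>A\<close> is not fixed by the hypothesis, so the absolute
      value provides the nonnegative constant.\<close>
    also have "A * L powr (- (real CARD('d) / p)) * \<psi> (ln (exp 1 + L))
       \<le> \<bar>A\<bar> * L powr (- (real CARD('d) / p)) * \<psi> (real (Suc k))"
    proof (intro mult_mono)
      \<comment> \<open>Since ln L = k + 1, the argument of \<psi> is at least k + 1, and
        monotonicity reduces it to the values in the summable series.\<close>
      have "ln L \<le> ln (exp 1 + L)" using L1 by (intro ln_mono) (auto intro: add_pos_nonneg)
      then have "real (Suc k) \<le> ln (exp 1 + L)" by (simp add: L_def)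
      then show "\<psi> (ln (exp 1 + L)) \<le> \<psi> (real (Suc k))" "0 \<le> \<psi> (ln (exp 1 + L))"
        using assms(4)[of "ln (exp 1 + L)"] by (auto intro!: monotone_onD[OF assms(5)])
    qed auto
    finally show "(\<integral>\<^sup>+x. ennreal (norm (g (x + h) - g x) powr p) \<partial>tor)
         \<le> ennreal ((\<bar>A\<bar> * exp (real (Suc k)) powr (- (real CARD('d) / p)) * \<psi> (real (Suc k))) powr p)"
      unfolding L_def[symmetric] by (rule nn_integral_translate_diff_le_modulus[OF g per fg p gp h])
  qed simp
  then have "AE x in torus_measure. ((\<lambda>n. psum n g x) \<longlongrightarrow> g x) pringsheim"
    by (rule AE_torus_measure)
  with fg0 show ?thesis
    by eventually_elim (simp add: rect_partial_sum_def psum_def coef)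
qed

end
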